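(* Let $\Psi$ be a set and $\mathfrak S_\Psi$ the group of all permutations of $\Psi$. Let $A$ be a left noetherian associative (unital) ring endowed with a smooth $\mathfrak S_\Psi$-action by ring automorphisms. Then any smooth finitely generated left $A\langle\mathfrak S_\Psi\rangle$-module $W$ is noetherian when considered as a left $A\langle U\rangle$-module, for any open subgroup $U\subseteq\mathfrak S_\Psi$.
   Context: $\mathfrak S_\Psi$ carries the topology in which the pointwise stabilizers of finite subsets of $\Psi$ form a base of neighbourhoods of the identity. An action of $\mathfrak S_\Psi$ on a set is smooth if the stabilizer of every element is open. For a ring $A$ with an action of a group $G$ by ring automorphisms $a\mapsto a^g$, $A\langle G\rangle$ is the ring of finite formal sums $\sum a_i[g_i]$ ($a_i\in A$, $g_i\in G$) with multiplication $(a[g])(b[h])=ab^g[gh]$. *)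

theory Defs
  imports
    "HOL-Algebra.Module"
    "HOL-Algebra.QuotRing"
    "HOL-Algebra.Group_Action"
    "HOL-Analysis.Abstract_Topology"
begin

subsection \<open>Left modules over associative unital rings\<close>

text \<open>The library locale \<^locale>\<open>module\<close> requires a commutative base ring; the axioms below are
  the same with \<^locale>\<open>ring\<close> in place of \<^locale>\<open>cring\<close>. The library predicate
  \<^const>\<open>submodule\<close> carries no commutativity assumption and is used as it is.\<close>

locale left_module = R?: ring R + M?: abelian_group M
  for R (structure) and M (structure) +
  assumes smult_closed:
      "\<lbrakk>a \<in> carrier R; x \<in> carrier M\<rbrakk> \<Longrightarrow> a \<odot>\<^bsub>M\<^esub> x \<in> carrier M"
    and smult_l_distr:
      "\<lbrakk>a \<in> carrier R; b \<in> carrier R; x \<in> carrier M\<rbrakk> \<Longrightarrow>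
        (a \<oplus>\<^bsub>R\<^esub> b) \<odot>\<^bsub>M\<^esub> x = a \<odot>\<^bsub>M\<^esub> x \<oplus>\<^bsub>M\<^esub> b \<odot>\<^bsub>M\<^esub> x"
    and smult_r_distr:
      "\<lbrakk>a \<in> carrier R; x \<in> carrier M; y \<in> carrier M\<rbrakk> \<Longrightarrow>
        a \<odot>\<^bsub>M\<^esub> (x \<oplus>\<^bsub>M\<^esub> y) = a \<odot>\<^bsub>M\<^esub> x \<oplus>\<^bsub>M\<^esub> a \<odot>\<^bsub>M\<^esub> y"
    and smult_assoc:
      "\<lbrakk>a \<in> carrier R; b \<in> carrier R; x \<in> carrier M\<rbrakk> \<Longrightarrow>
        (a \<otimes>\<^bsub>R\<^esub> b) \<odot>\<^bsub>M\<^esub> x = a \<odot>\<^bsub>M\<^esub> (b \<odot>\<^bsub>M\<^esub> x)"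
    and smult_one:
      "x \<in> carrier M \<Longrightarrow> \<one>\<^bsub>R\<^esub> \<odot>\<^bsub>M\<^esub> x = x"

definition generated_submodule ::
    "('r, 'k) ring_scheme \<Rightarrow> ('r, 'm, 'l) module_scheme \<Rightarrow> 'm set \<Rightarrow> 'm set"
  where "generated_submodule R M S = \<Inter>{N. submodule N R M \<and> S \<subseteq> N}"

definition finitely_generated_module ::
    "('r, 'k) ring_scheme \<Rightarrow> ('r, 'm, 'l) module_scheme \<Rightarrow> bool"
  where "finitely_generated_module R M \<longleftrightarrow> left_module R M \<and>
    (\<exists>S. finite S \<and> S \<subseteq> carrier M \<and> generated_submodule R M S = carrier M)"

definition noetherian_module ::
    "('r, 'k) ring_scheme \<Rightarrow> ('r, 'm, 'l) module_scheme \<Rightarrow> bool"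
  where "noetherian_module R M \<longleftrightarrow> left_module R M \<and>
    (\<forall>N. submodule N R M \<longrightarrow>
      (\<exists>S. finite S \<and> S \<subseteq> carrier M \<and> generated_submodule R M S = N))"

definition left_regular_module :: "('r, 'k) ring_scheme \<Rightarrow> ('r, 'r) module"
  where "left_regular_module R =
    \<lparr>carrier = carrier R, mult = mult R, one = one R, zero = zero R, add = add R,
     smult = mult R\<rparr>"

definition left_noetherian_ring :: "('r, 'k) ring_scheme \<Rightarrow> bool"
  where "left_noetherian_ring R \<longleftrightarrow> ring R \<and> noetherian_module R (left_regular_module R)"


subsection \<open>Skew group rings\<close>

definition ring_action ::
    "('g, 'k) monoid_scheme \<Rightarrow> ('a, 'l) ring_scheme \<Rightarrow> ('g \<Rightarrow> 'a \<Rightarrow> 'a) \<Rightarrow> bool"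
  where "ring_action G A \<phi> \<longleftrightarrow>
    group_action G (carrier A) \<phi> \<and> (\<forall>g \<in> carrier G. \<phi> g \<in> ring_iso A A)"

text \<open>A formal sum is its coefficient function, which is \<open>\<zero>\<close> off \<open>carrier G\<close>. Hence for
  a subgroup \<open>U\<close> of \<open>G\<close> the carrier of the ring over \<open>G\<lparr>carrier := U\<rparr>\<close> is literally a
  subset of the carrier of the ring over \<open>G\<close>, and modules over the latter are restricted to the
  former without changing the record. The product is the biadditive extension of
  \<open>(a[g])(b[h]) = a b\<^sup>g [gh]\<close>, where \<open>b\<^sup>g = \<phi> g b\<close>.\<close>

definition monomial :: "('a, 'l) ring_scheme \<Rightarrow> 'a \<Rightarrow> 'g \<Rightarrow> 'g \<Rightarrow> 'a"
  where "monomial A a g = (\<lambda>x. if x = g then a else \<zero>\<^bsub>A\<^esub>)"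

definition skew_group_ring ::
    "('a, 'l) ring_scheme \<Rightarrow> ('g, 'k) monoid_scheme \<Rightarrow> ('g \<Rightarrow> 'a \<Rightarrow> 'a) \<Rightarrow> ('g \<Rightarrow> 'a) ring"
  where "skew_group_ring A G \<phi> =
    \<lparr>carrier = {p. (\<forall>g. p g \<in> carrier A) \<and> {g. p g \<noteq> \<zero>\<^bsub>A\<^esub>} \<subseteq> carrier G \<and>
                   finite {g. p g \<noteq> \<zero>\<^bsub>A\<^esub>}},
     mult = (\<lambda>p q x. finsum A (\<lambda>(g, h). p g \<otimes>\<^bsub>A\<^esub> \<phi> g (q h))
               {(g, h). g \<in> carrier G \<and> h \<in> carrier G \<and>
                  p g \<noteq> \<zero>\<^bsub>A\<^esub> \<and> q h \<noteq> \<zero>\<^bsub>A\<^esub> \<and> g \<otimes>\<^bsub>G\<^esub> h = x}),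
     one = monomial A \<one>\<^bsub>A\<^esub> \<one>\<^bsub>G\<^esub>,
     zero = (\<lambda>x. \<zero>\<^bsub>A\<^esub>),
     add = (\<lambda>p q x. p x \<oplus>\<^bsub>A\<^esub> q x)\<rparr>"

lemma monomial_in_skew_group_ring:
  assumes "ring A" "a \<in> carrier A" "g \<in> carrier G"
  shows "monomial A a g \<in> carrier (skew_group_ring A G \<phi>)"
proof -
  interpret A: ring A by fact
  have "{x. monomial A a g x \<noteq> \<zero>\<^bsub>A\<^esub>} \<subseteq> {g}"
    by (auto simp: monomial_def)
  then show ?thesis
    using assms by (auto simp: skew_group_ring_def monomial_def intro: finite_subset)
qed

lemma monomial_mult:
  assumes "ring A" "group G" "ring_action G A \<phi>"
    and "a \<in> carrier A" "b \<in> carrier A" "g \<in> carrier G" "h \<in> carrier G"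
  shows "monomial A a g \<otimes>\<^bsub>skew_group_ring A G \<phi>\<^esub> monomial A b h
    = monomial A (a \<otimes>\<^bsub>A\<^esub> \<phi> g b) (g \<otimes>\<^bsub>G\<^esub> h)"
proof
  fix x
  interpret A: ring A by fact
  have hom: "\<phi> g \<in> ring_hom A A"
    using assms by (auto simp: ring_action_def ring_iso_def)
  have cl: "\<phi> g b \<in> carrier A"
    using hom assms(5) by (rule ring_hom_closed)
  have z: "\<phi> g \<zero>\<^bsub>A\<^esub> = \<zero>\<^bsub>A\<^esub>"
    using hom assms(1) by (simp add: ring_hom_zero)
  let ?I = "{(g', h'). g' \<in> carrier G \<and> h' \<in> carrier G \<and> monomial A a g g' \<noteq> \<zero>\<^bsub>A\<^esub> \<and>
    monomial A b h h' \<noteq> \<zero>\<^bsub>A\<^esub> \<and> g' \<otimes>\<^bsub>G\<^esub> h' = x}"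
  have I: "?I = (if a \<noteq> \<zero>\<^bsub>A\<^esub> \<and> b \<noteq> \<zero>\<^bsub>A\<^esub> \<and> g \<otimes>\<^bsub>G\<^esub> h = x then {(g, h)} else {})"
    using assms(6,7) by (auto simp: monomial_def split: if_splits)
  have "(monomial A a g \<otimes>\<^bsub>skew_group_ring A G \<phi>\<^esub> monomial A b h) x
      = finsum A (\<lambda>(g', h'). monomial A a g g' \<otimes>\<^bsub>A\<^esub> \<phi> g' (monomial A b h h')) ?I"
    by (simp add: skew_group_ring_def)
  also have "\<dots> = monomial A (a \<otimes>\<^bsub>A\<^esub> \<phi> g b) (g \<otimes>\<^bsub>G\<^esub> h) x"
    unfolding I using assms(4,5) cl z
    by (auto simp: A.finsum_insert monomial_def)
  finally show "(monomial A a g \<otimes>\<^bsub>skew_group_ring A G \<phi>\<^esub> monomial A b h) x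
      = monomial A (a \<otimes>\<^bsub>A\<^esub> \<phi> g b) (g \<otimes>\<^bsub>G\<^esub> h) x" .
qed

text \<open>The action \<open>w \<mapsto> [g]w\<close> of the group on a module over its skew group ring.\<close>

definition skew_module_action ::
    "('a, 'l) ring_scheme \<Rightarrow> ('g \<Rightarrow> 'a, 'w, 'n) module_scheme \<Rightarrow> 'g \<Rightarrow> 'w \<Rightarrow> 'w"
  where "skew_module_action A W g = (\<lambda>w \<in> carrier W. monomial A \<one>\<^bsub>A\<^esub> g \<odot>\<^bsub>W\<^esub> w)"


subsection \<open>The topology of the symmetric group and smooth actions\<close>

definition pointwise_stabilizer :: "'p set \<Rightarrow> 'p set \<Rightarrow> ('p \<Rightarrow> 'p) set"
  where "pointwise_stabilizer \<Psi> F = {g \<in> carrier (BijGroup \<Psi>). \<forall>x \<in> F. g x = x}"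

definition sym_topology :: "'p set \<Rightarrow> ('p \<Rightarrow> 'p) topology"
  where "sym_topology \<Psi> = topology (\<lambda>V. V \<subseteq> carrier (BijGroup \<Psi>) \<and>
    (\<forall>g \<in> V. \<exists>F. finite F \<and> F \<subseteq> \<Psi> \<and> g <#\<^bsub>BijGroup \<Psi>\<^esub> pointwise_stabilizer \<Psi> F \<subseteq> V))"

lemma openin_sym_topology:
  "openin (sym_topology \<Psi>) V \<longleftrightarrow> V \<subseteq> carrier (BijGroup \<Psi>) \<and>
    (\<forall>g \<in> V. \<exists>F. finite F \<and> F \<subseteq> \<Psi> \<and> g <#\<^bsub>BijGroup \<Psi>\<^esub> pointwise_stabilizer \<Psi> F \<subseteq> V)"
proof -
  let ?O = "\<lambda>V. V \<subseteq> carrier (BijGroup \<Psi>) \<and>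
    (\<forall>g \<in> V. \<exists>F. finite F \<and> F \<subseteq> \<Psi> \<and> g <#\<^bsub>BijGroup \<Psi>\<^esub> pointwise_stabilizer \<Psi> F \<subseteq> V)"
  have mono: "g <#\<^bsub>BijGroup \<Psi>\<^esub> pointwise_stabilizer \<Psi> (F \<union> F')
      \<subseteq> (g <#\<^bsub>BijGroup \<Psi>\<^esub> pointwise_stabilizer \<Psi> F) \<inter> (g <#\<^bsub>BijGroup \<Psi>\<^esub> pointwise_stabilizer \<Psi> F')"
    for g F F'
    by (auto simp: l_coset_def pointwise_stabilizer_def)
  have "istopology ?O"
    unfolding istopology_def
  proof (intro conjI allI impI)
    fix V V' assume V: "?O V" and V': "?O V'"
    show "V \<inter> V' \<subseteq> carrier (BijGroup \<Psi>)" using V by blast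
    show "\<forall>g \<in> V \<inter> V'. \<exists>F. finite F \<and> F \<subseteq> \<Psi> \<and>
        g <#\<^bsub>BijGroup \<Psi>\<^esub> pointwise_stabilizer \<Psi> F \<subseteq> V \<inter> V'"
    proof
      fix g assume g: "g \<in> V \<inter> V'"
      obtain F where F: "finite F" "F \<subseteq> \<Psi>"
          "g <#\<^bsub>BijGroup \<Psi>\<^esub> pointwise_stabilizer \<Psi> F \<subseteq> V"
        using V g by blast
      obtain F' where F': "finite F'" "F' \<subseteq> \<Psi>"
          "g <#\<^bsub>BijGroup \<Psi>\<^esub> pointwise_stabilizer \<Psi> F' \<subseteq> V'"
        using V' g by blast
      show "\<exists>F. finite F \<and> F \<subseteq> \<Psi> \<and> g <#\<^bsub>BijGroup \<Psi>\<^esub> pointwise_stabilizer \<Psi> F \<subseteq> V \<inter> V'"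
        using F F' mono[of g F F'] by (intro exI[of _ "F \<union> F'"]) auto
    qed
  next
    fix K assume K: "\<forall>V\<in>K. ?O V"
    show "\<Union>K \<subseteq> carrier (BijGroup \<Psi>)" using K by blast
    show "\<forall>g \<in> \<Union>K. \<exists>F. finite F \<and> F \<subseteq> \<Psi> \<and>
        g <#\<^bsub>BijGroup \<Psi>\<^esub> pointwise_stabilizer \<Psi> F \<subseteq> \<Union>K"
      using K by (meson UnionE Union_upper subset_trans)
  qed
  then show ?thesis
    by (simp add: sym_topology_def topology_inverse')
qed

lemma openin_pointwise_stabilizer:
  assumes "finite F" "F \<subseteq> \<Psi>"
  shows "openin (sym_topology \<Psi>) (pointwise_stabilizer \<Psi> F)"
proof -
  have "g <#\<^bsub>BijGroup \<Psi>\<^esub> pointwise_stabilizer \<Psi> F \<subseteq> pointwise_stabilizer \<Psi> F"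
    if "g \<in> pointwise_stabilizer \<Psi> F" for g
    using that assms(2)
    by (auto simp: l_coset_def pointwise_stabilizer_def BijGroup_def compose_Bij compose_def)
       (metis compose_Bij compose_def)
  then show ?thesis
    using assms by (auto simp: openin_sym_topology pointwise_stabilizer_def)
qed

lemma sym_topology_base_at_one:
  assumes "openin (sym_topology \<Psi>) V" "\<one>\<^bsub>BijGroup \<Psi>\<^esub> \<in> V"
  obtains F where "finite F" "F \<subseteq> \<Psi>" "pointwise_stabilizer \<Psi> F \<subseteq> V"
proof -
  interpret group "BijGroup \<Psi>" by (rule group_BijGroup)
  obtain F where F: "finite F" "F \<subseteq> \<Psi>"
      "\<one>\<^bsub>BijGroup \<Psi>\<^esub> <#\<^bsub>BijGroup \<Psi>\<^esub> pointwise_stabilizer \<Psi> F \<subseteq> V"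
    using assms by (auto simp: openin_sym_topology)
  have "\<one>\<^bsub>BijGroup \<Psi>\<^esub> <#\<^bsub>BijGroup \<Psi>\<^esub> pointwise_stabilizer \<Psi> F = pointwise_stabilizer \<Psi> F"
    by (rule lcos_mult_one) (auto simp: pointwise_stabilizer_def)
  with F show thesis using that by simp
qed

definition smooth_action :: "'p set \<Rightarrow> 'e set \<Rightarrow> (('p \<Rightarrow> 'p) \<Rightarrow> 'e \<Rightarrow> 'e) \<Rightarrow> bool"
  where "smooth_action \<Psi> E \<phi> \<longleftrightarrow> group_action (BijGroup \<Psi>) E \<phi> \<and>
    (\<forall>x \<in> E. openin (sym_topology \<Psi>) (stabilizer (BijGroup \<Psi>) \<phi> x))"

end

theory Submission
  imports Defs
begin

text \<open>
  A smooth finitely generated module is a quotient of a free \<open>A\<close>-module on a set \<open>X\<close> on which the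
  symmetric group acts so that every \<open>x \<in> X\<close> has a finite support \<open>s x\<close>, equivariant in \<open>x\<close>, of bounded
  size, and only finitely many \<open>x\<close> are supported in a given finite set. Let \<open>M\<close> be a submodule of the
  free module that is stable under the pointwise stabilizer of a finite set \<open>T\<close>, and let \<open>k\<close> be the
  maximal number of points of \<open>s x\<close> outside \<open>T\<close>; the proof is by induction on \<open>k\<close>. Fix a \<open>k\<close>-set \<open>I\<close>
  disjoint from \<open>T\<close>. The coefficients of elements of \<open>M\<close> at the finitely many \<open>x\<close> with \<open>s x - T = I\<close>
  form a module of finite type over the noetherian ring \<open>A\<close>, generated by a finite set \<open>B \<subseteq> M\<close>; let \<open>J\<close>
  be a finite set containing \<open>T\<close>, \<open>I\<close> and all supports occurring in \<open>B\<close>. If \<open>Y\<close> is a \<open>k\<close>-set disjoint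
  from \<open>J\<close>, a permutation exchanging \<open>I\<close> and \<open>Y\<close> and fixing \<open>J - I\<close> carries \<open>B\<close> to elements that
  cancel the coefficients of a given \<open>m \<in> M\<close> at all \<open>x\<close> with \<open>s x - T = Y\<close>, and otherwise change \<open>m\<close>
  only at \<open>x\<close> with fewer than \<open>k\<close> points of \<open>s x\<close> outside \<open>J\<close>. So modulo \<open>B\<close> only the latter remain,
  and the induction hypothesis applies to them with \<open>J\<close> in place of \<open>T\<close>.
\<close>

section \<open>Permutations exchanging two disjoint finite sets\<close>

text \<open>Take a bijection from \<open>I\<close> onto \<open>Y\<close>, its inverse on
  \<open>Y\<close> and the identity elsewhere. As \<open>I\<close> lies in \<open>J\<close> and
  \<open>J\<close> misses \<open>Y\<close>, the two pieces do not overlap, and the result is an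
  involution.\<close>

lemma BijGroup_exchange:
  assumes "finite I" "finite Y" "card I = card Y" "I \<subseteq> J" "J \<subseteq> \<Psi>" "Y \<subseteq> \<Psi>" "J \<inter> Y = {}"
  obtains g where "g \<in> carrier (BijGroup \<Psi>)" "g ` I = Y" "\<And>x. x \<in> J - I \<Longrightarrow> g x = x"
proof -
  obtain h where h: "bij_betw h I Y"
    using assms(1-3) finite_same_card_bij by blast
  define k where "k = inv_into I h"
  have k: "bij_betw k Y I"
    unfolding k_def using h by (rule bij_betw_inv_into)
  have hk: "\<And>y. y \<in> Y \<Longrightarrow> h (k y) = y" "\<And>x. x \<in> I \<Longrightarrow> k (h x) = x"
    unfolding k_def using h by (auto simp: bij_betw_inv_into_right bij_betw_inv_into_left)
  have hY: "\<And>x. x \<in> I \<Longrightarrow> h x \<in> Y" and kI: "\<And>y. y \<in> Y \<Longrightarrow> k y \<in> I"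
    using h k by (auto simp: bij_betw_def)
  \<comment> \<open>The restriction to \<open>\<Psi>\<close> is there because \<open>Bij\<close>
    contains only extensional functions.\<close>
  define g where "g = (\<lambda>x\<in>\<Psi>. if x \<in> I then h x else if x \<in> Y then k x else x)"
  have into: "g x \<in> \<Psi>" if "x \<in> \<Psi>" for x
    using that hY kI assms(4-6) by (auto simp: g_def)
  have invol: "g (g x) = x" if "x \<in> \<Psi>" for x
    using that into[OF that] hY kI hk assms(4,7) by (auto simp: g_def)
  have "bij_betw g \<Psi> \<Psi>"
    by (rule bij_betw_byWitness[where f' = g]) (use into invol in auto)
  then have "g \<in> carrier (BijGroup \<Psi>)"
    by (simp add: BijGroup_def Bij_def g_def)
  moreover have "g ` I = Y"
  proof -
    have "g ` I = h ` I"
      using assms(4,5) by (intro image_cong) (auto simp: g_def)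
    then show ?thesis using h by (simp add: bij_betw_def)
  qed
  moreover have "g x = x" if "x \<in> J - I" for x
    using that assms(5,7) by (auto simp: g_def)
  ultimately show thesis using that by blast
qed

subsection \<open>Free modules on sets with finite supports\<close>

text \<open>The support is a separate datum attached to an index. In the application an index is a
  pair of a vector and a finite set, moved in both components, and \<open>s\<close> is the second
  projection; \<open>finite_supported\<close> then comes from smoothness.\<close>

locale supported_action =
  fixes \<Psi> :: "'p set" and A :: "('a, 'l) ring_scheme" (structure)
    and \<phi> :: "('p \<Rightarrow> 'p) \<Rightarrow> 'a \<Rightarrow> 'a"
    and X :: "'x set" and \<tau> :: "('p \<Rightarrow> 'p) \<Rightarrow> 'x \<Rightarrow> 'x" and s :: "'x \<Rightarrow> 'p set"
  assumes noetherian: "left_noetherian_ring A"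
    and coefficient_action: "ring_action (BijGroup \<Psi>) A \<phi>"
    and index_closed: "\<lbrakk>g \<in> carrier (BijGroup \<Psi>); x \<in> X\<rbrakk> \<Longrightarrow> \<tau> g x \<in> X"
    and index_one: "x \<in> X \<Longrightarrow> \<tau> \<one>\<^bsub>BijGroup \<Psi>\<^esub> x = x"
    and index_mult: "\<lbrakk>g \<in> carrier (BijGroup \<Psi>); h \<in> carrier (BijGroup \<Psi>); x \<in> X\<rbrakk> \<Longrightarrow>
      \<tau> (g \<otimes>\<^bsub>BijGroup \<Psi>\<^esub> h) x = \<tau> g (\<tau> h x)"
    and support_subset: "x \<in> X \<Longrightarrow> s x \<subseteq> \<Psi>"
    and finite_support: "x \<in> X \<Longrightarrow> finite (s x)"
    and support_equivariant:
      "\<lbrakk>g \<in> carrier (BijGroup \<Psi>); x \<in> X\<rbrakk> \<Longrightarrow> s (\<tau> g x) = g ` s x"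
    and finite_supported: "finite J \<Longrightarrow> finite {x \<in> X. s x \<subseteq> J}"
begin

sublocale ring A
  using noetherian by (simp add: left_noetherian_ring_def)

sublocale coeff: group_action "BijGroup \<Psi>" "carrier A" \<phi>
  using coefficient_action by (simp add: ring_action_def)

sublocale Sym: group "BijGroup \<Psi>"
  by (rule group_BijGroup)

abbreviation \<open>Sym \<equiv> BijGroup \<Psi>\<close>

lemma coeff_hom: "g \<in> carrier Sym \<Longrightarrow> \<phi> g \<in> ring_hom A A"
  using coefficient_action by (auto simp: ring_action_def ring_iso_def)

lemma coeff_closed: "\<lbrakk>g \<in> carrier Sym; a \<in> carrier A\<rbrakk> \<Longrightarrow> \<phi> g a \<in> carrier A"
  using coeff_hom ring_hom_closed by metis

lemma coeff_zero: "g \<in> carrier Sym \<Longrightarrow> \<phi> g \<zero> = \<zero>"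
  using coeff_hom ring_hom_zero ring_axioms by metis

section \<open>Submodules of the free module and the semilinear action on it\<close>

definition free_module :: "('x \<Rightarrow> 'a) set"
  where "free_module = {f. (\<forall>x. f x \<in> carrier A) \<and> {x. f x \<noteq> \<zero>} \<subseteq> X \<and> finite {x. f x \<noteq> \<zero>}}"

text \<open>This action sends \<open>a\<close> times the basis vector at \<open>x\<close> to
  \<open>\<phi> g a\<close> times the one at \<open>\<tau> g x\<close>. As \<open>\<tau>\<close> is
  constrained only on \<open>X\<close>, the value off \<open>X\<close> is set to zero by
  hand.\<close>

definition translate :: "('p \<Rightarrow> 'p) \<Rightarrow> ('x \<Rightarrow> 'a) \<Rightarrow> 'x \<Rightarrow> 'a"
  where "translate g f = (\<lambda>x. if x \<in> X then \<phi> g (f (\<tau> (inv\<^bsub>Sym\<^esub> g) x)) else \<zero>)"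

definition linear_subset :: "('x \<Rightarrow> 'a) set \<Rightarrow> bool"
  where "linear_subset M \<longleftrightarrow> M \<subseteq> free_module \<and> (\<lambda>x. \<zero>) \<in> M \<and>
    (\<forall>f\<in>M. \<forall>h\<in>M. (\<lambda>x. f x \<oplus> h x) \<in> M) \<and> (\<forall>a\<in>carrier A. \<forall>f\<in>M. (\<lambda>x. a \<otimes> f x) \<in> M)"

text \<open>These are the submodules over the skew group ring of the pointwise stabilizer of
  \<open>T\<close>.\<close>

definition stable_subset :: "'p set \<Rightarrow> ('x \<Rightarrow> 'a) set \<Rightarrow> bool"
  where "stable_subset T M \<longleftrightarrow> linear_subset M \<and>
    (\<forall>g\<in>pointwise_stabilizer \<Psi> T. \<forall>f\<in>M. translate g f \<in> M)"

lemma free_module_closed: "f \<in> free_module \<Longrightarrow> f x \<in> carrier A"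
  by (simp add: free_module_def)

lemma linear_subsetD:
  assumes "linear_subset M"
  shows "M \<subseteq> free_module" "(\<lambda>x. \<zero>) \<in> M"
    and "\<lbrakk>f \<in> M; h \<in> M\<rbrakk> \<Longrightarrow> (\<lambda>x. f x \<oplus> h x) \<in> M"
    and "\<lbrakk>a \<in> carrier A; f \<in> M\<rbrakk> \<Longrightarrow> (\<lambda>x. a \<otimes> f x) \<in> M"
  using assms by (simp_all add: linear_subset_def)

lemma linear_subset_closed: "\<lbrakk>linear_subset M; f \<in> M\<rbrakk> \<Longrightarrow> f x \<in> carrier A"
  using free_module_closed linear_subsetD(1) by blast

lemma linear_subset_diff:
  assumes "linear_subset M" "f \<in> M" "h \<in> M"
  shows "(\<lambda>x. f x \<ominus> h x) \<in> M"
proof -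
  have cl: "\<And>x. f x \<in> carrier A" "\<And>x. h x \<in> carrier A"
    using assms linear_subset_closed by simp_all
  have "(\<lambda>x. f x \<oplus> (\<ominus> \<one>) \<otimes> h x) \<in> M"
    using assms by (simp add: linear_subset_def)
  then show ?thesis
    using cl by (simp add: a_minus_def l_minus)
qed

lemma linear_subset_Int:
  "linear_subset M \<Longrightarrow> linear_subset N \<Longrightarrow> linear_subset (M \<inter> N)"
  by (simp add: linear_subset_def le_infI1)

lemma stable_subset_Int:
  "stable_subset T M \<Longrightarrow> stable_subset T N \<Longrightarrow> stable_subset T (M \<inter> N)"
  by (simp add: stable_subset_def linear_subset_Int)

lemma pointwise_stabilizer_antimono:
  "T \<subseteq> J \<Longrightarrow> pointwise_stabilizer \<Psi> J \<subseteq> pointwise_stabilizer \<Psi> T"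
  by (auto simp: pointwise_stabilizer_def)

lemma stable_subset_mono: "stable_subset T M \<Longrightarrow> T \<subseteq> J \<Longrightarrow> stable_subset J M"
  using subsetD[OF pointwise_stabilizer_antimono] by (simp add: stable_subset_def)

lemma linear_subset_vanishing: "linear_subset {f \<in> free_module. \<forall>x. P x \<longrightarrow> f x = \<zero>}"
proof -
  have "(\<lambda>x. f x \<oplus> h x) \<in> free_module" if "f \<in> free_module" "h \<in> free_module" for f h
  proof -
    have "{x. f x \<oplus> h x \<noteq> \<zero>} \<subseteq> {x. f x \<noteq> \<zero>} \<union> {x. h x \<noteq> \<zero>}" by auto
    with that show ?thesis
      unfolding free_module_def by (auto intro: finite_subset)
  qed
  moreover have "(\<lambda>x. a \<otimes> f x) \<in> free_module" if "a \<in> carrier A" "f \<in> free_module" for a f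
  proof -
    have "{x. a \<otimes> f x \<noteq> \<zero>} \<subseteq> {x. f x \<noteq> \<zero>}" using that by auto
    with that show ?thesis
      unfolding free_module_def by (auto intro: finite_subset)
  qed
  ultimately show ?thesis
    by (auto simp: linear_subset_def) (simp_all add: free_module_def)
qed

lemma index_inv_closed: "g \<in> carrier Sym \<Longrightarrow> x \<in> X \<Longrightarrow> \<tau> (inv\<^bsub>Sym\<^esub> g) x \<in> X"
  by (simp add: index_closed)

lemma index_cancel:
  assumes "g \<in> carrier Sym" "x \<in> X"
  shows "\<tau> g (\<tau> (inv\<^bsub>Sym\<^esub> g) x) = x" "\<tau> (inv\<^bsub>Sym\<^esub> g) (\<tau> g x) = x"
  using assms index_mult[of g "inv\<^bsub>Sym\<^esub> g" x] index_mult[of "inv\<^bsub>Sym\<^esub> g" g x]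
  by (simp_all add: index_one)

lemma coeff_cancel:
  assumes "g \<in> carrier Sym" "a \<in> carrier A"
  shows "\<phi> g (\<phi> (inv\<^bsub>Sym\<^esub> g) a) = a"
  using assms coeff.composition_rule[of a g "inv\<^bsub>Sym\<^esub> g"] 
  by (simp add: coeff.id_eq_one[symmetric])

lemma translate_support:
  assumes "g \<in> carrier Sym"
  shows "{x. translate g f x \<noteq> \<zero>} \<subseteq> \<tau> g ` {x. f x \<noteq> \<zero>}"
proof
  fix x assume "x \<in> {x. translate g f x \<noteq> \<zero>}"
  then have "x \<in> X" "f (\<tau> (inv\<^bsub>Sym\<^esub> g) x) \<noteq> \<zero>"
    using coeff_zero[OF assms] by (auto simp: translate_def split: if_splits)
  then show "x \<in> \<tau> g ` {x. f x \<noteq> \<zero>}"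
    using index_cancel(1)[OF assms] by (metis (mono_tags) imageI mem_Collect_eq)
qed

lemma translate_closed:
  assumes "g \<in> carrier Sym" "f \<in> free_module"
  shows "translate g f \<in> free_module"
proof -
  have "finite (\<tau> g ` {x. f x \<noteq> \<zero>})"
    using assms(2) by (simp add: free_module_def)
  then have "finite {x. translate g f x \<noteq> \<zero>}"
    by (rule finite_subset[OF translate_support[OF assms(1)]])
  then show ?thesis
    using assms coeff_closed by (auto simp: free_module_def translate_def)
qed

text \<open>A translate takes its value at \<open>x\<close> from the index that \<open>g\<close>
  carries to \<open>x\<close>. Were \<open>P\<close> true there, it would be true at
  \<open>x\<close>; so where \<open>P\<close> fails the translate only sees zeros.\<close>

lemma stable_subset_vanishing:
  assumes "\<And>g x. g \<in> pointwise_stabilizer \<Psi> J \<Longrightarrow> x \<in> X \<Longrightarrow> P x \<Longrightarrow> P (\<tau> g x)"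
  shows "stable_subset J {f \<in> free_module. \<forall>x. \<not> P x \<longrightarrow> f x = \<zero>}"
proof -
  have "translate g f x = \<zero>"
    if g: "g \<in> pointwise_stabilizer \<Psi> J" and f: "\<forall>x. \<not> P x \<longrightarrow> f x = \<zero>" and x: "\<not> P x" for g f x
  proof (cases "x \<in> X")
    case True
    have g': "g \<in> carrier Sym" using g by (simp add: pointwise_stabilizer_def)
    have "f (\<tau> (inv\<^bsub>Sym\<^esub> g) x) = \<zero>"
      using assms[OF g index_inv_closed[OF g' True]] index_cancel(1)[OF g' True] f x by auto
    then show ?thesis
      using coeff_zero[OF g'] by (simp add: translate_def)
  qed (simp add: translate_def)
  then show ?thesis
    using linear_subset_vanishing[of "\<lambda>x. \<not> P x"] translate_closed
    by (auto simp: stable_subset_def pointwise_stabilizer_def)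
qed

text \<open>Fixing \<open>T\<close> pointwise, \<open>g\<close> maps \<open>T\<close> onto itself,
  and being injective it commutes with the set difference. Hence the number of support points
  outside \<open>T\<close> is invariant under the stabilizer of \<open>T\<close>.\<close>

lemma support_diff_translate:
  assumes g: "g \<in> carrier Sym" "\<And>y. y \<in> T \<Longrightarrow> g y = y" and T: "T \<subseteq> \<Psi>" and x: "x \<in> X"
  shows "s (\<tau> g x) - T = g ` (s x - T)"
proof -
  have inj: "inj_on g \<Psi>"
    using g(1) by (simp add: BijGroup_def Bij_def bij_betw_def)
  have "g ` T = T"
    using g(2) by auto
  then have "s (\<tau> g x) - T = g ` s x - g ` T"
    using support_equivariant[OF g(1) x] by simp
  also have "\<dots> = g ` (s x - T)"
    using inj_on_image_set_diff[OF inj, of "s x" T] support_subset[OF x] T by auto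
  finally show ?thesis .
qed

text \<open>Being generated by \<open>B\<close> is expressed by quantifying over all submodules that contain \<open>B\<close>.\<close>

lemma restriction_finitely_generated:
  assumes "finite Z" "linear_subset M"
  shows "\<exists>B. finite B \<and> B \<subseteq> M \<and>
    (\<forall>N. linear_subset N \<and> B \<subseteq> N \<longrightarrow> (\<forall>m\<in>M. \<exists>n\<in>N. \<forall>z\<in>Z. m z = n z))"
  using assms
\<comment> \<open>Coordinates are added one at a time: the values at the new \<open>z\<close> of the
  elements of \<open>M\<close> vanishing on \<open>Z\<close> form a left ideal, finitely generated
  as \<open>A\<close> is left noetherian.\<close>
proof (induction Z rule: finite_induct)
  case empty
  then show ?case
    by (intro exI[of _ "{}"]) (auto simp: linear_subset_def)
next
  case (insert z Z)
  obtain B where B: "finite B" "B \<subseteq> M"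
    and "\<forall>N. linear_subset N \<and> B \<subseteq> N \<longrightarrow> (\<forall>m\<in>M. \<exists>n\<in>N. \<forall>z\<in>Z. m z = n z)"
    using insert.IH[OF insert.prems] by (elim exE conjE)
  then have gen: "\<And>N m. linear_subset N \<Longrightarrow> B \<subseteq> N \<Longrightarrow> m \<in> M \<Longrightarrow> \<exists>n\<in>N. \<forall>z\<in>Z. m z = n z"
    by simp
  define M' where "M' = M \<inter> {f \<in> free_module. \<forall>x. x \<in> Z \<longrightarrow> f x = \<zero>}"
  have M': "linear_subset M'"
    unfolding M'_def by (intro linear_subset_Int insert.prems linear_subset_vanishing)
  have ideal: "submodule ((\<lambda>f. f z) ` K) A (left_regular_module A)" if K: "linear_subset K" for K
  proof -
    have cl: "f x \<in> carrier A" if "f \<in> K" for f x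
      using linear_subset_closed[OF K that] .
    have "\<ominus> (f z) \<in> (\<lambda>f. f z) ` K" if f: "f \<in> K" for f
    proof -
      have "(\<lambda>x. (\<ominus> \<one>) \<otimes> f x) \<in> K"
        using K f by (simp add: linear_subset_def)
      then have "(\<ominus> \<one>) \<otimes> f z \<in> (\<lambda>f. f z) ` K" by (rule image_eqI[rotated]) simp
      then show ?thesis using cl[OF f] by (simp add: l_minus)
    qed
    moreover have "f z \<oplus> h z \<in> (\<lambda>f. f z) ` K" if "f \<in> K" "h \<in> K" for f h
      by (rule image_eqI[where x = "\<lambda>x. f x \<oplus> h x"]) (simp_all add: linear_subsetD(3)[OF K that])
    moreover have "a \<otimes> f z \<in> (\<lambda>f. f z) ` K" if "a \<in> carrier A" "f \<in> K" for a f
      by (rule image_eqI[where x = "\<lambda>x. a \<otimes> f x"]) (simp_all add: linear_subsetD(4)[OF K that])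
    moreover have "\<zero> \<in> (\<lambda>f. f z) ` K"
      by (rule image_eqI[where x = "\<lambda>x. \<zero>"]) (simp_all add: linear_subsetD(2)[OF K])
    ultimately show ?thesis
      using cl
      by (intro submodule.intro subgroup.intro submodule_axioms.intro)
        (auto simp: left_regular_module_def a_inv_def m_inv_def)
  qed
  have "\<exists>S. finite S \<and> S \<subseteq> carrier (left_regular_module A) \<and>
      generated_submodule A (left_regular_module A) S = (\<lambda>f. f z) ` M'"
    using noetherian ideal[OF M'] unfolding left_noetherian_ring_def noetherian_module_def
    by (elim conjE allE[where x = "(\<lambda>f. f z) ` M'"]) simp
  then obtain C where C: "finite C" "generated_submodule A (left_regular_module A) C = (\<lambda>f. f z) ` M'"
    by (elim exE conjE)
  have "C \<subseteq> generated_submodule A (left_regular_module A) C"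
    unfolding generated_submodule_def by (rule Inter_greatest) simp
  then have "C \<subseteq> (\<lambda>f. f z) ` M'"
    unfolding C(2) .
  \<comment> \<open>\<open>D\<close> lifts the generators of the ideal to \<open>M'\<close>.\<close>
  then obtain D where D: "finite D" "D \<subseteq> M'" "C = (\<lambda>f. f z) ` D"
    using finite_subset_image[OF C(1)] by metis
  have "\<exists>n\<in>N. \<forall>z\<in>insert z Z. m z = n z"
    if N: "linear_subset N" "B \<union> D \<subseteq> N" and m: "m \<in> M" for N m
  proof -
    \<comment> \<open>Using \<open>gen\<close> for \<open>N \<inter> M\<close> instead of
      \<open>N\<close> keeps \<open>n\<close> in \<open>M\<close>, so that the difference of
      \<open>m\<close> and \<open>n\<close> lies in \<open>M'\<close>.\<close>
    obtain n where n: "n \<in> N" "n \<in> M" "\<forall>z\<in>Z. m z = n z"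
    proof -
      have "B \<subseteq> N \<inter> M" using N(2) B(2) by simp
      then obtain n where "n \<in> N \<inter> M" "\<forall>z\<in>Z. m z = n z"
        using gen[OF linear_subset_Int[OF N(1) insert.prems(1)] _ m] by blast
      then show thesis by (intro that[of n]) auto
    qed
    have "(\<lambda>x. m x \<ominus> n x) \<in> M"
      by (rule linear_subset_diff[OF insert.prems m n(2)])
    moreover have "m x \<ominus> n x = \<zero>" if "x \<in> Z" for x
      using n(3) that linear_subset_closed[OF insert.prems n(2)] by (simp add: a_minus_def r_neg)
    ultimately have d: "(\<lambda>x. m x \<ominus> n x) \<in> M'"
      using linear_subsetD(1)[OF insert.prems] unfolding M'_def by blast
    \<comment> \<open>The values at \<open>z\<close> on \<open>N \<inter> M'\<close> form an ideal
      containing \<open>C\<close>, hence contain all values of \<open>M'\<close> at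
      \<open>z\<close>.\<close>
    have "generated_submodule A (left_regular_module A) C \<subseteq> (\<lambda>f. f z) ` (N \<inter> M')"
    proof -
      have "C \<subseteq> (\<lambda>f. f z) ` (N \<inter> M')"
        unfolding D(3) using D(2) N(2) by (intro image_mono) simp
      then show ?thesis
        unfolding generated_submodule_def
        using ideal[OF linear_subset_Int[OF N(1) M']] by (intro Inter_lower) simp
    qed
    then have "m z \<ominus> n z \<in> (\<lambda>f. f z) ` (N \<inter> M')"
      unfolding C(2) using imageI[OF d, of "\<lambda>f. f z"] by (rule subsetD)
    \<comment> \<open>Since \<open>k\<close> vanishes on \<open>Z\<close>, adding it to
      \<open>n\<close> corrects the coordinate \<open>z\<close> and leaves the others.\<close>
    then obtain k where k: "k \<in> N" "k \<in> M'" "m z \<ominus> n z = k z" by auto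
    have "(\<lambda>x. n x \<oplus> k x) \<in> N"
      using linear_subsetD(3)[OF N(1) n(1) k(1)] .
    moreover have "m x = n x \<oplus> k x" if "x \<in> insert z Z" for x
    proof -
      have cl: "m x \<in> carrier A" "n x \<in> carrier A" "k x \<in> carrier A"
        using linear_subset_closed insert.prems N(1) m n(2) k(1) by blast+
      show ?thesis
      proof (cases "x = z")
        case True
        then show ?thesis using k(3)[symmetric] cl
          by (simp add: a_minus_def a_lcomm[of "n z" "m z"] r_neg)
      next
        case False
        then show ?thesis using that n(3) k(2) cl by (simp add: M'_def)
      qed
    qed
    ultimately show ?thesis
      by (intro bexI[where x = "\<lambda>x. n x \<oplus> k x"] ballI)
  qed
  moreover have "B \<union> D \<subseteq> M"
    using B(2) D(2) unfolding M'_def by blast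
  ultimately show ?case
    using B(1) D(1) by (intro exI[of _ "B \<union> D"] conjI allI impI ballI) simp_all
qed

section \<open>Induction on the number of support points outside the fixed set\<close>

text \<open>The cancellation that drives the induction, stated for every stable \<open>N\<close>
  between \<open>B\<close> and \<open>M\<close>: subtracting elements of \<open>N\<close> then stays
  in \<open>M\<close>, where the bound on supports holds.\<close>

lemma finite_generation_step:
  assumes T: "finite T" "T \<subseteq> \<Psi>" and I: "finite I" "I \<subseteq> \<Psi>" "I \<inter> T = {}"
    and M: "stable_subset T M"
    and bound: "\<And>f x. f \<in> M \<Longrightarrow> f x \<noteq> \<zero> \<Longrightarrow> card (s x - T) \<le> card I"
  obtains B J where "finite B" "B \<subseteq> M" "finite J" "T \<subseteq> J" "J \<subseteq> \<Psi>"
    and "\<And>N m. stable_subset T N \<Longrightarrow> B \<subseteq> N \<Longrightarrow> N \<subseteq> M \<Longrightarrow> m \<in> M \<Longrightarrow>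
      \<exists>n\<in>N. \<forall>x. m x \<ominus> n x \<noteq> \<zero> \<longrightarrow> card (s x - J) < card I"
proof -
  have lin: "linear_subset M"
    using M by (simp add: stable_subset_def)
  \<comment> \<open>The supports of these indices lie in \<open>T \<union> I\<close>, so there are
    only finitely many of them.\<close>
  define Z where "Z = {x \<in> X. s x - T = I}"
  have "Z \<subseteq> {x \<in> X. s x \<subseteq> T \<union> I}"
    by (auto simp: Z_def)
  then have "finite Z"
    using finite_supported[of "T \<union> I"] T(1) I(1) by (meson finite_UnI finite_subset)
  from restriction_finitely_generated[OF this lin]
  obtain B where B: "finite B" "B \<subseteq> M" and "\<forall>N. linear_subset N \<and> B \<subseteq> N \<longrightarrow>
      (\<forall>m\<in>M. \<exists>n\<in>N. \<forall>z\<in>Z. m z = n z)"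
    by (elim exE conjE)
  then have gen: "\<exists>n\<in>N. \<forall>z\<in>Z. m z = n z" if "linear_subset N" "B \<subseteq> N" "m \<in> M" for N m
    using that by simp
  define J where "J = T \<union> I \<union> (\<Union>b\<in>B. \<Union>x\<in>{x. b x \<noteq> \<zero>}. s x)"
  have BF: "b \<in> free_module" if "b \<in> B" for b
    using that B(2) linear_subsetD(1)[OF lin] by blast
  have supp_X: "x \<in> X" if "f \<in> free_module" "f x \<noteq> \<zero>" for f x
    using that by (auto simp: free_module_def)
  have J: "finite J" "T \<subseteq> J" "I \<subseteq> J" "J \<subseteq> \<Psi>"
  proof -
    have "finite {x. b x \<noteq> \<zero>}" if "b \<in> B" for b
      using BF[OF that] by (simp add: free_module_def)
    moreover have "finite (s x)" if "b \<in> B" "b x \<noteq> \<zero>" for b x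
      using finite_support[OF supp_X[OF BF[OF that(1)] that(2)]] .
    ultimately show "finite J"
      unfolding J_def using T(1) I(1) B(1) by (intro finite_UnI finite_UN_I) simp_all
    show "J \<subseteq> \<Psi>"
      unfolding J_def using T(2) I(2) BF supp_X support_subset by blast
  qed (auto simp: J_def)
  \<comment> \<open>An index occurring in an element of \<open>M\<close> can keep
    \<open>card I\<close> support points outside \<open>J\<close> only if its support outside
    \<open>T\<close> has \<open>card I\<close> points and misses \<open>J\<close>. These sets have
    to be eliminated.\<close>
  define bad where "bad m = {Y. \<exists>x. m x \<noteq> \<zero> \<and> Y = s x - T \<and> Y \<inter> J = {} \<and> card Y = card I}"
    for m :: "'x \<Rightarrow> 'a"
  have finite_bad: "finite (bad m)" if "m \<in> M" for m
  proof -
    have "bad m \<subseteq> (\<lambda>x. s x - T) ` {x. m x \<noteq> \<zero>}"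
      by (auto simp: bad_def)
    moreover have "finite {x. m x \<noteq> \<zero>}"
      using that linear_subsetD(1)[OF lin] by (auto simp: free_module_def)
    ultimately show ?thesis by (meson finite_imageI finite_subset)
  qed
  \<comment> \<open>Subtracting one translate removes \<open>Y\<close> from the bad sets and creates
    no new one.\<close>
  have reduce: "\<exists>n\<in>N. bad (\<lambda>x. m x \<ominus> n x) \<subset> bad m"
    if N: "stable_subset T N" "B \<subseteq> N" and m: "m \<in> M" and Y: "Y \<in> bad m" for N m Y
  proof -
    obtain x0 where x0: "m x0 \<noteq> \<zero>" "Y = s x0 - T" and Y': "Y \<inter> J = {}" "card Y = card I"
      using Y by (auto simp: bad_def)
    have x0X: "x0 \<in> X" using m x0(1) supp_X linear_subsetD(1)[OF lin] by blast
    have YP: "finite Y" "Y \<subseteq> \<Psi>"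
      unfolding x0(2) using finite_support[OF x0X] support_subset[OF x0X] by auto
    \<comment> \<open>Since \<open>I\<close> misses \<open>T\<close>, fixing \<open>J - I\<close>
      includes fixing \<open>T\<close>, so \<open>M\<close> and \<open>N\<close> are stable under
      \<open>g\<close> and its inverse.\<close>
    obtain g where g: "g \<in> carrier Sym" "g ` I = Y" "\<And>x. x \<in> J - I \<Longrightarrow> g x = x"
      using BijGroup_exchange[OF I(1) YP(1) Y'(2)[symmetric] J(3,4) YP(2)] Y'(1) by (metis inf_commute)
    have inj: "inj_on g \<Psi>"
      using g(1) by (simp add: BijGroup_def Bij_def bij_betw_def)
    have gT: "g x = x" if "x \<in> T" for x
      using that J(2) I(3) g(3) by blast
    let ?g' = "inv\<^bsub>Sym\<^esub> g"
    have stab: "g \<in> pointwise_stabilizer \<Psi> T" "?g' \<in> pointwise_stabilizer \<Psi> T"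
    proof -
      show "g \<in> pointwise_stabilizer \<Psi> T"
        using g(1) gT by (simp add: pointwise_stabilizer_def)
      have "?g' x = x" if "x \<in> T" for x
        using that T(2) g(1) gT inj inv_BijGroup[of g \<Psi>] inv_into_f_f[OF inj, of x]
        by (auto simp: BijGroup_def)
      then show "?g' \<in> pointwise_stabilizer \<Psi> T"
        using g(1) by (simp add: pointwise_stabilizer_def)
    qed
    \<comment> \<open>Translating by the inverse moves the coefficients of \<open>m\<close> over
      \<open>Y\<close> to indices in \<open>Z\<close>, where elements generated by \<open>B\<close>
      can match them.\<close>
    have "translate ?g' m \<in> M"
      using M m stab(2) by (simp add: stable_subset_def)
    \<comment> \<open>Intersecting with \<open>?V\<close> makes the matching \<open>n\<close>
      supported inside \<open>J\<close>; \<open>B\<close> lies in \<open>?V\<close> by the choice of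
      \<open>J\<close>. In general \<open>?V\<close> is not stable, but \<open>gen\<close> asks only
      for linearity.\<close>
    let ?V = "{f \<in> free_module. \<forall>x. \<not> s x \<subseteq> J \<longrightarrow> f x = \<zero>}"
    have "B \<subseteq> N \<inter> ?V"
      using N(2) BF by (auto simp: J_def)
    moreover have "linear_subset (N \<inter> ?V)"
      using N(1) by (intro linear_subset_Int linear_subset_vanishing) (simp add: stable_subset_def)
    ultimately obtain n where n: "n \<in> N \<inter> ?V" "\<forall>z\<in>Z. translate ?g' m z = n z"
      using gen \<open>translate ?g' m \<in> M\<close> by blast
    have nF: "n \<in> free_module" and nJ: "\<And>x. n x \<noteq> \<zero> \<Longrightarrow> s x \<subseteq> J" and "n \<in> N"
      using n(1) by auto
    have gn: "translate g n \<in> N"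
      using N(1) stab(1) \<open>n \<in> N\<close> by (simp add: stable_subset_def)
    have mA: "m x \<in> carrier A" for x
      by (rule linear_subset_closed[OF lin m])
    have gnA: "translate g n x \<in> carrier A" for x
      by (rule free_module_closed[OF translate_closed[OF g(1) nF]])
    \<comment> \<open>The index \<open>\<tau> ?g' x\<close> lies in \<open>Z\<close>, so
      \<open>n\<close> has there the coefficient of the pulled back \<open>m\<close>, and
      translating by \<open>g\<close> restores it.\<close>
    have eq: "translate g n x = m x" if x: "x \<in> X" "s x - T = Y" for x
    proof -
      define y where "y = \<tau> ?g' x"
      have y: "y \<in> X" "\<tau> g y = x"
        using index_inv_closed[OF g(1) x(1)] index_cancel(1)[OF g(1) x(1)] by (simp_all add: y_def)
      have "g ` (s y - T) = g ` I"
        using support_diff_translate[OF g(1) gT T(2) y(1)] y(2) x(2) g(2) by simp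
      then have "s y - T = I"
        using inj_on_image_eq_iff[OF inj, of "s y - T" I] support_subset[OF y(1)] I(2) by auto
      then have "n y = translate ?g' m y"
        using n(2) y(1) by (simp add: Z_def)
      also have "\<dots> = \<phi> ?g' (m x)"
        using y g(1) by (simp add: translate_def)
      finally show ?thesis
        using x(1) coeff_cancel[OF g(1) mA] by (simp add: translate_def y_def)
    qed
    have supp_gn: "s x \<subseteq> J \<union> Y" if x: "translate g n x \<noteq> \<zero>" for x
    proof -
      have xX: "x \<in> X" and ne: "n (\<tau> ?g' x) \<noteq> \<zero>"
        using x coeff_zero[OF g(1)] by (auto simp: translate_def split: if_splits)
      have "s x = g ` s (\<tau> ?g' x)"
        using support_equivariant[OF g(1) index_inv_closed[OF g(1) xX]] index_cancel(1)[OF g(1) xX] by simp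
      also have "\<dots> \<subseteq> g ` J"
        using nJ[OF ne] by (rule image_mono)
      also have "\<dots> \<subseteq> J \<union> Y"
        using g(2,3) by (metis Diff_iff UnCI image_eqI image_subsetI)
      finally show ?thesis .
    qed
    have "Y \<notin> bad (\<lambda>x. m x \<ominus> translate g n x)"
    proof
      assume "Y \<in> bad (\<lambda>x. m x \<ominus> translate g n x)"
      then obtain x where x: "m x \<ominus> translate g n x \<noteq> \<zero>" "Y = s x - T"
        by (auto simp: bad_def)
      have "x \<in> X"
        using x(1) m nF supp_X[OF linear_subsetD(1)[OF lin, THEN subsetD, OF m]]
          supp_X[OF translate_closed[OF g(1) nF]] by (metis a_minus_def local.minus_zero r_zero zero_closed)
      then show False
        using eq[of x] x mA[of x] by (simp add: a_minus_def r_neg)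
    qed
    \<comment> \<open>A bad set not coming from \<open>m\<close> comes from the translate, so it
      lies in \<open>J \<union> Y\<close> and misses \<open>J\<close>; having as many points as
      \<open>Y\<close>, it equals \<open>Y\<close>.\<close>
    moreover have "bad (\<lambda>x. m x \<ominus> translate g n x) \<subseteq> insert Y (bad m)"
    proof
      fix V assume V: "V \<in> bad (\<lambda>x. m x \<ominus> translate g n x)"
      then obtain x where x: "m x \<ominus> translate g n x \<noteq> \<zero>" "V = s x - T" "V \<inter> J = {}" "card V = card I"
        by (auto simp: bad_def)
      show "V \<in> insert Y (bad m)"
      proof (cases "m x = \<zero>")
        case True
        then have "translate g n x \<noteq> \<zero>"
          using x(1) by (auto simp: a_minus_def)
        then have "V \<subseteq> Y"
          using supp_gn x(2,3) by blast
        then show ?thesis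
          using card_subset_eq[OF YP(1)] x(4) Y'(2) by simp
      next
        case False
        then show ?thesis using x by (auto simp: bad_def)
      qed
    qed
    ultimately have "bad (\<lambda>x. m x \<ominus> translate g n x) \<subset> bad m"
      using Y by blast
    then show ?thesis using gn by blast
  qed
  \<comment> \<open>The reduction is repeated; the finite number of bad sets drops each
    time.\<close>
  have main: "\<exists>n\<in>N. bad (\<lambda>x. m x \<ominus> n x) = {}"
    if N: "stable_subset T N" "B \<subseteq> N" "N \<subseteq> M" and m: "m \<in> M" for N m
    using m
  proof (induction "card (bad m)" arbitrary: m rule: less_induct)
    case less
    have Nlin: "linear_subset N" using N(1) by (simp add: stable_subset_def)
    show ?case
    proof (cases "bad m = {}")
      case True
      have "(\<lambda>x. m x \<ominus> \<zero>) = m"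
        using linear_subset_closed[OF lin less.prems] by (simp add: a_minus_def)
      then show ?thesis
        using True by (intro bexI[of _ "\<lambda>x. \<zero>"] linear_subsetD(2)[OF Nlin]) simp
    next
      case False
      then obtain n where n: "n \<in> N" "bad (\<lambda>x. m x \<ominus> n x) \<subset> bad m"
        using reduce[OF N(1,2) less.prems] by blast
      let ?m = "\<lambda>x. m x \<ominus> n x"
      have "?m \<in> M"
        using linear_subset_diff[OF lin less.prems] n(1) N(3) by blast
      moreover have "card (bad ?m) < card (bad m)"
        using psubset_card_mono[OF finite_bad[OF less.prems] n(2)] .
      ultimately obtain k where k: "k \<in> N" "bad (\<lambda>x. ?m x \<ominus> k x) = {}"
        using less.hyps by blast
      have "(\<lambda>x. ?m x \<ominus> k x) = (\<lambda>x. m x \<ominus> (n x \<oplus> k x))"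
      proof
        fix x
        have "m x \<in> carrier A" "n x \<in> carrier A" "k x \<in> carrier A"
          using linear_subset_closed lin Nlin less.prems n(1) k(1) by blast+
        then show "?m x \<ominus> k x = m x \<ominus> (n x \<oplus> k x)"
          by (simp add: a_minus_def minus_add a_assoc)
      qed
      with k(2) have "bad (\<lambda>x. m x \<ominus> (n x \<oplus> k x)) = {}" by simp
      then show ?thesis
        using linear_subsetD(3)[OF Nlin n(1) k(1)] by (rule bexI)
    qed
  qed
  have "\<exists>n\<in>N. \<forall>x. m x \<ominus> n x \<noteq> \<zero> \<longrightarrow> card (s x - J) < card I"
    if N: "stable_subset T N" "B \<subseteq> N" "N \<subseteq> M" and m: "m \<in> M" for N m
  proof -
    obtain n where n: "n \<in> N" "bad (\<lambda>x. m x \<ominus> n x) = {}"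
      using main[OF N m] by blast
    have d: "(\<lambda>x. m x \<ominus> n x) \<in> M"
      using linear_subset_diff[OF lin m] n(1) N(3) by blast
    have "card (s x - J) < card I" if x: "m x \<ominus> n x \<noteq> \<zero>" for x
    proof -
      have "x \<in> X"
        using supp_X[of "\<lambda>x. m x \<ominus> n x" x] d linear_subsetD(1)[OF lin] x by blast
      then have fin: "finite (s x - T)"
        using finite_support by simp
      have le: "card (s x - T) \<le> card I"
        using bound[OF d] x by simp
      show ?thesis
      \<comment> \<open>Either \<open>J\<close> removes at least one point more than
        \<open>T\<close> does, or it removes nothing more and the count is below
        \<open>card I\<close> because no bad set is left.\<close>
      proof (cases "(s x - T) \<inter> J = {}")
        case True
        then have "card (s x - T) \<noteq> card I"
          using n(2) x by (auto simp: bad_def)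
        moreover have "s x - J = s x - T" using True J(2) by blast
        ultimately show ?thesis using le by simp
      next
        case False
        then have "s x - J \<subset> s x - T" using J(2) by blast
        from psubset_card_mono[OF fin this] le show ?thesis by simp
      qed
    qed
    then show ?thesis using n(1) by blast
  qed
  then show thesis
    using that[OF B J(1,2,4)] by simp
qed

text \<open>The bound is strict so that \<open>k = 0\<close> forces \<open>M\<close> to be zero.
  \<open>T\<close> and \<open>M\<close> vary in the induction, because each step passes to a larger
  set \<open>J\<close> outside which fewer support points remain.\<close>

lemma stable_subset_finitely_generated:
  assumes "finite T" "T \<subseteq> \<Psi>" "stable_subset T M"
    and "\<And>f x. f \<in> M \<Longrightarrow> f x \<noteq> \<zero> \<Longrightarrow> card (s x - T) < k"
  shows "\<exists>B. finite B \<and> B \<subseteq> M \<and> (\<forall>N. stable_subset T N \<and> B \<subseteq> N \<longrightarrow> M \<subseteq> N)"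
  using assms
proof (induction k arbitrary: T M)
  case 0
  have "M \<subseteq> {\<lambda>x. \<zero>}"
    using 0(4) by auto
  then have "M \<subseteq> N" if "stable_subset T N" for N
    using that linear_subsetD(2)[of N] by (auto simp: stable_subset_def)
  then show ?case by (intro exI[of _ "{}"]) simp
next
  case (Suc k)
  show ?case
  proof (cases "\<forall>f\<in>M. \<forall>x. f x \<noteq> \<zero> \<longrightarrow> card (s x - T) < k")
    case True
    then show ?thesis using Suc.IH[OF Suc.prems(1-3)] by simp
  next
    case False
    \<comment> \<open>Some index has exactly \<open>k\<close> support points outside
      \<open>T\<close>; they serve as \<open>I\<close>.\<close>
    then obtain f x where fx: "f \<in> M" "f x \<noteq> \<zero>" "\<not> card (s x - T) < k" by blast
    have lin: "linear_subset M"
      using Suc.prems(3) by (simp add: stable_subset_def)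
    have x: "x \<in> X"
      using linear_subsetD(1)[OF lin] fx(1,2) by (auto simp: free_module_def)
    define I where "I = s x - T"
    have I: "finite I" "I \<subseteq> \<Psi>" "I \<inter> T = {}"
      using finite_support[OF x] support_subset[OF x] by (auto simp: I_def)
    have cI: "card I = k"
      using Suc.prems(4)[OF fx(1,2)] fx(3) by (simp add: I_def)
    have "card (s x - T) \<le> card I" if "f \<in> M" "f x \<noteq> \<zero>" for f x
      using Suc.prems(4)[OF that] cI by simp
    then obtain B J where B: "finite B" "B \<subseteq> M" and J: "finite J" "T \<subseteq> J" "J \<subseteq> \<Psi>"
      and red: "\<And>N m. stable_subset T N \<Longrightarrow> B \<subseteq> N \<Longrightarrow> N \<subseteq> M \<Longrightarrow> m \<in> M \<Longrightarrow>
        \<exists>n\<in>N. \<forall>x. m x \<ominus> n x \<noteq> \<zero> \<longrightarrow> card (s x - J) < card I"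
      using finite_generation_step[OF Suc.prems(1,2) I Suc.prems(3)] by metis
    \<comment> \<open>What remains after the cancellation lies in \<open>M \<inter> ?V\<close>. This
      is stable over \<open>J\<close>, though not in general over \<open>T\<close>, and the
      induction hypothesis applies to it.\<close>
    let ?V = "{f \<in> free_module. \<forall>x. \<not> card (s x - J) < k \<longrightarrow> f x = \<zero>}"
    have "card (s (\<tau> g x) - J) < k"
      if g: "g \<in> pointwise_stabilizer \<Psi> J" and x: "x \<in> X" and lt: "card (s x - J) < k" for g x
    proof -
      have "s (\<tau> g x) - J = g ` (s x - J)"
        using g by (intro support_diff_translate J(3) x) (auto simp: pointwise_stabilizer_def)
      then show ?thesis
        using card_image_le[of "s x - J" g] finite_support[OF x] lt by simp
    qed
    then have V: "stable_subset J ?V"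
      by (rule stable_subset_vanishing)
    have MV: "stable_subset J (M \<inter> ?V)"
      by (intro stable_subset_Int V stable_subset_mono[OF Suc.prems(3) J(2)])
    have "\<exists>C. finite C \<and> C \<subseteq> M \<inter> ?V \<and> (\<forall>N. stable_subset J N \<and> C \<subseteq> N \<longrightarrow> M \<inter> ?V \<subseteq> N)"
      by (rule Suc.IH[OF J(1,3) MV]) blast
    then obtain C where C: "finite C" "C \<subseteq> M \<inter> ?V"
      and genC: "\<forall>N. stable_subset J N \<and> C \<subseteq> N \<longrightarrow> M \<inter> ?V \<subseteq> N"
      by (elim exE conjE)
    have "M \<subseteq> N" if N: "stable_subset T N" "B \<union> C \<subseteq> N" for N
    proof
      fix m assume m: "m \<in> M"
      have NM: "stable_subset T (N \<inter> M)"
        by (intro stable_subset_Int N(1) Suc.prems(3))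
      have "B \<subseteq> N \<inter> M" using N(2) B(2) by simp
      then obtain n where n: "n \<in> N" "n \<in> M" "\<forall>x. m x \<ominus> n x \<noteq> \<zero> \<longrightarrow> card (s x - J) < k"
        using red[OF NM _ _ m] cI by blast
      have d: "(\<lambda>x. m x \<ominus> n x) \<in> M"
        by (rule linear_subset_diff[OF lin m n(2)])
      then have "(\<lambda>x. m x \<ominus> n x) \<in> M \<inter> ?V"
        using n(3) linear_subsetD(1)[OF lin] by blast
      \<comment> \<open>A set stable over \<open>T\<close> is stable over the larger
        \<open>J\<close>, so the generators \<open>C\<close> can be used for
        \<open>N\<close>.\<close>
      moreover have "M \<inter> ?V \<subseteq> N"
        using genC stable_subset_mono[OF N(1) J(2)] N(2) by simp
      ultimately have dN: "(\<lambda>x. m x \<ominus> n x) \<in> N" by (rule subsetD[rotated])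
      have "(\<lambda>x. n x \<oplus> (m x \<ominus> n x)) \<in> N"
        using N(1) n(1) dN linear_subsetD(3)[of N n "\<lambda>x. m x \<ominus> n x"] by (simp add: stable_subset_def)
      moreover have "n x \<oplus> (m x \<ominus> n x) = m x" for x
        using linear_subset_closed[OF lin m, of x] linear_subset_closed[OF lin n(2), of x]
        by (simp add: a_minus_def a_lcomm[of "n x" "m x"] r_neg)
      ultimately show "m \<in> N" by simp
    qed
    then show ?thesis
      using B C by (intro exI[of _ "B \<union> C"] conjI allI impI) simp_all
  qed
qed

end

subsection \<open>Restriction of skew group rings to subgroups\<close>

lemma skew_group_ring_sel:
  "zero (skew_group_ring A G \<phi>) = (\<lambda>x. \<zero>\<^bsub>A\<^esub>)"
  "add (skew_group_ring A G \<phi>) = (\<lambda>p q x. p x \<oplus>\<^bsub>A\<^esub> q x)"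
  "one (skew_group_ring A G \<phi>) = monomial A \<one>\<^bsub>A\<^esub> \<one>\<^bsub>G\<^esub>"
  by (simp_all add: skew_group_ring_def)

lemma carrier_skew_group_ring_subgroup:
  assumes "U \<subseteq> carrier G"
  shows "p \<in> carrier (skew_group_ring A (G\<lparr>carrier := U\<rparr>) \<phi>) \<longleftrightarrow>
    p \<in> carrier (skew_group_ring A G \<phi>) \<and> {g. p g \<noteq> \<zero>\<^bsub>A\<^esub>} \<subseteq> U"
  using assms by (auto simp: skew_group_ring_def)

lemma mult_skew_group_ring_subgroup:
  assumes "U \<subseteq> carrier G"
    and "p \<in> carrier (skew_group_ring A (G\<lparr>carrier := U\<rparr>) \<phi>)"
    and "q \<in> carrier (skew_group_ring A (G\<lparr>carrier := U\<rparr>) \<phi>)"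
  shows "p \<otimes>\<^bsub>skew_group_ring A (G\<lparr>carrier := U\<rparr>) \<phi>\<^esub> q = p \<otimes>\<^bsub>skew_group_ring A G \<phi>\<^esub> q"
proof -
  have "{(g, h). g \<in> U \<and> h \<in> U \<and> p g \<noteq> \<zero>\<^bsub>A\<^esub> \<and> q h \<noteq> \<zero>\<^bsub>A\<^esub> \<and> g \<otimes>\<^bsub>G\<^esub> h = x}
      = {(g, h). g \<in> carrier G \<and> h \<in> carrier G \<and> p g \<noteq> \<zero>\<^bsub>A\<^esub> \<and> q h \<noteq> \<zero>\<^bsub>A\<^esub> \<and> g \<otimes>\<^bsub>G\<^esub> h = x}"
    for x
    using assms by (auto simp: carrier_skew_group_ring_subgroup)
  then show ?thesis
    by (simp add: skew_group_ring_def)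
qed

text \<open>The axioms of the larger ring are assumed, being part of the module structure on
  \<open>W\<close>. They restrict to the functions supported in \<open>U\<close>, so what has to be
  checked is closure.\<close>

lemma ring_skew_group_ring_subgroup:
  assumes A: "ring A" and R: "ring (skew_group_ring A G \<phi>)" and U: "subgroup U G"
  shows "ring (skew_group_ring A (G\<lparr>carrier := U\<rparr>) \<phi>)" (is "ring ?R'")
proof -
  let ?R = "skew_group_ring A G \<phi>"
  interpret A: ring A by fact
  interpret R: ring ?R by fact
  interpret U: subgroup U G by fact
  note in_iff = carrier_skew_group_ring_subgroup[OF U.subset, of _ A \<phi>]
  note mult_eq = mult_skew_group_ring_subgroup[OF U.subset, of _ A \<phi>]
  have sub: "p \<in> carrier ?R" if "p \<in> carrier ?R'" for p
    using that in_iff by blast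
  have add_eq: "p \<oplus>\<^bsub>?R'\<^esub> q = p \<oplus>\<^bsub>?R\<^esub> q" for p q
    by (simp add: skew_group_ring_sel)
  have zero_eq: "\<zero>\<^bsub>?R'\<^esub> = \<zero>\<^bsub>?R\<^esub>" and one_eq: "\<one>\<^bsub>?R'\<^esub> = \<one>\<^bsub>?R\<^esub>"
    by (simp_all add: skew_group_ring_sel)
  have add_closed: "p \<oplus>\<^bsub>?R\<^esub> q \<in> carrier ?R'" if p: "p \<in> carrier ?R'" and q: "q \<in> carrier ?R'" for p q
  proof -
    have "{g. (p \<oplus>\<^bsub>?R\<^esub> q) g \<noteq> \<zero>\<^bsub>A\<^esub>} \<subseteq> {g. p g \<noteq> \<zero>\<^bsub>A\<^esub>} \<union> {g. q g \<noteq> \<zero>\<^bsub>A\<^esub>}"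
      by (auto simp: skew_group_ring_sel)
    then show ?thesis
      using p q R.a_closed[OF sub sub] by (simp add: in_iff) blast
  qed
  have mult_closed: "p \<otimes>\<^bsub>?R\<^esub> q \<in> carrier ?R'" if p: "p \<in> carrier ?R'" and q: "q \<in> carrier ?R'" for p q
  proof -
    have "(p \<otimes>\<^bsub>?R\<^esub> q) x = \<zero>\<^bsub>A\<^esub>" if "x \<notin> U" for x
    proof -
      have empty: "{(g, h). g \<in> carrier G \<and> h \<in> carrier G \<and> p g \<noteq> \<zero>\<^bsub>A\<^esub> \<and> q h \<noteq> \<zero>\<^bsub>A\<^esub> \<and> g \<otimes>\<^bsub>G\<^esub> h = x} = {}"
        using that p q U.m_closed by (auto simp: in_iff)
      show ?thesis
        unfolding skew_group_ring_def by (simp add: empty)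
    qed
    then show ?thesis
      using p q R.m_closed[OF sub sub] by (simp add: in_iff) blast
  qed
  have zero_closed: "\<zero>\<^bsub>?R\<^esub> \<in> carrier ?R'"
    using R.zero_closed by (simp add: in_iff) (simp add: skew_group_ring_sel)
  have one_closed: "\<one>\<^bsub>?R\<^esub> \<in> carrier ?R'"
    using R.one_closed U.one_closed by (simp add: in_iff) (auto simp: skew_group_ring_sel monomial_def)
  have neg_closed: "\<ominus>\<^bsub>?R\<^esub> p \<in> carrier ?R'" if p: "p \<in> carrier ?R'" for p
  proof -
    have "\<ominus>\<^bsub>?R\<^esub> p \<oplus>\<^bsub>?R\<^esub> p = \<zero>\<^bsub>?R\<^esub>"
      using sub[OF p] by (rule R.l_neg)
    \<comment> \<open>The negative is known only through the group law; read pointwise, the law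
      shows that it vanishes wherever \<open>p\<close> does.\<close>
    then have "(\<ominus>\<^bsub>?R\<^esub> p) g \<oplus>\<^bsub>A\<^esub> p g = \<zero>\<^bsub>A\<^esub>" for g
      unfolding skew_group_ring_sel by (rule fun_cong)
    moreover have "(\<ominus>\<^bsub>?R\<^esub> p) g \<in> carrier A" for g
      using R.a_inv_closed[OF sub[OF p]] by (simp add: skew_group_ring_def)
    ultimately have "p g \<noteq> \<zero>\<^bsub>A\<^esub>" if "(\<ominus>\<^bsub>?R\<^esub> p) g \<noteq> \<zero>\<^bsub>A\<^esub>" for g
      using that by (metis A.r_zero)
    then show ?thesis
      using p R.a_inv_closed[OF sub[OF p]] by (simp add: in_iff) blast
  qed
  show ?thesis
  proof (intro ringI abelian_groupI monoidI)
    show "\<exists>y\<in>carrier ?R'. y \<oplus>\<^bsub>?R'\<^esub> x = \<zero>\<^bsub>?R'\<^esub>" if "x \<in> carrier ?R'" for x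
      using neg_closed[OF that] R.l_neg[OF sub[OF that]] by (auto simp: add_eq zero_eq)
  qed (simp_all add: add_eq zero_eq one_eq mult_eq add_closed mult_closed zero_closed one_closed sub
      R.a_assoc R.m_assoc R.l_distr R.r_distr R.a_comm R.a_lcomm)
qed

lemma left_module_skew_group_ring_subgroup:
  assumes "ring A" and sub_G: "subgroup U G" and W: "left_module (skew_group_ring A G \<phi>) W"
  shows "left_module (skew_group_ring A (G\<lparr>carrier := U\<rparr>) \<phi>) W" (is "left_module ?R' W")
proof -
  interpret W: left_module "skew_group_ring A G \<phi>" W by fact
  have U: "U \<subseteq> carrier G"
    using sub_G by (rule subgroup.subset)
  have R': "ring ?R'"
    using assms(1) W.R.ring_axioms sub_G by (rule ring_skew_group_ring_subgroup)
  have sub: "p \<in> carrier (skew_group_ring A G \<phi>)" if "p \<in> carrier ?R'" for p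
    using that carrier_skew_group_ring_subgroup[OF U] by blast
  show ?thesis
  proof (intro left_module.intro left_module_axioms.intro R' W.M.abelian_group_axioms)
    fix p q w assume pq: "p \<in> carrier ?R'" "q \<in> carrier ?R'" and w: "w \<in> carrier W"
    show "(p \<oplus>\<^bsub>?R'\<^esub> q) \<odot>\<^bsub>W\<^esub> w = p \<odot>\<^bsub>W\<^esub> w \<oplus>\<^bsub>W\<^esub> q \<odot>\<^bsub>W\<^esub> w"
      using W.smult_l_distr[OF sub sub w] pq by (simp add: skew_group_ring_sel)
    show "(p \<otimes>\<^bsub>?R'\<^esub> q) \<odot>\<^bsub>W\<^esub> w = p \<odot>\<^bsub>W\<^esub> (q \<odot>\<^bsub>W\<^esub> w)"
      using W.smult_assoc[OF sub sub w] pq by (simp add: mult_skew_group_ring_subgroup[OF U])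
  next
    fix w assume "w \<in> carrier W"
    then show "\<one>\<^bsub>?R'\<^esub> \<odot>\<^bsub>W\<^esub> w = w"
      using W.smult_one by (simp add: skew_group_ring_sel)
  qed (simp_all add: W.smult_closed W.smult_r_distr sub)
qed

section \<open>Elementary facts about left modules\<close>

lemma (in left_module) zero_smult:
  assumes "x \<in> carrier M"
  shows "\<zero>\<^bsub>R\<^esub> \<odot>\<^bsub>M\<^esub> x = \<zero>\<^bsub>M\<^esub>"
proof -
  have cl: "\<zero>\<^bsub>R\<^esub> \<odot>\<^bsub>M\<^esub> x \<in> carrier M"
    using assms by (simp add: smult_closed)
  have "\<zero>\<^bsub>R\<^esub> \<odot>\<^bsub>M\<^esub> x \<oplus>\<^bsub>M\<^esub> \<zero>\<^bsub>R\<^esub> \<odot>\<^bsub>M\<^esub> x = \<zero>\<^bsub>R\<^esub> \<odot>\<^bsub>M\<^esub> x"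
    using smult_l_distr[of "\<zero>\<^bsub>R\<^esub>" "\<zero>\<^bsub>R\<^esub>" x] assms by simp
  then show ?thesis
    using cl by simp
qed

lemma (in left_module) smult_zero:
  assumes "a \<in> carrier R"
  shows "a \<odot>\<^bsub>M\<^esub> \<zero>\<^bsub>M\<^esub> = \<zero>\<^bsub>M\<^esub>"
proof -
  have cl: "a \<odot>\<^bsub>M\<^esub> \<zero>\<^bsub>M\<^esub> \<in> carrier M"
    using assms by (simp add: smult_closed)
  have "a \<odot>\<^bsub>M\<^esub> \<zero>\<^bsub>M\<^esub> \<oplus>\<^bsub>M\<^esub> a \<odot>\<^bsub>M\<^esub> \<zero>\<^bsub>M\<^esub> = a \<odot>\<^bsub>M\<^esub> \<zero>\<^bsub>M\<^esub>"
    using smult_r_distr[of a "\<zero>\<^bsub>M\<^esub>" "\<zero>\<^bsub>M\<^esub>"] assms by simp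
  then show ?thesis
    using cl by simp
qed

lemma (in left_module) smult_finsum:
  assumes "a \<in> carrier R" "f \<in> I \<rightarrow> carrier M"
  shows "a \<odot>\<^bsub>M\<^esub> finsum M f I = finsum M (\<lambda>i. a \<odot>\<^bsub>M\<^esub> f i) I"
  using assms(2)
\<comment> \<open>For infinite \<open>I\<close> both sums are zero by convention, and
  \<open>smult_zero\<close> reconciles them.\<close>
proof (induction I rule: infinite_finite_induct)
  case (insert i I)
  then have "(\<lambda>i. a \<odot>\<^bsub>M\<^esub> f i) \<in> I \<rightarrow> carrier M"
    using smult_closed[OF assms(1)] by auto
  with insert show ?case
    using assms(1) by (simp add: M.finsum_insert smult_r_distr smult_closed M.finsum_closed Pi_iff)
qed (simp_all add: assms(1) smult_zero M.finsum_infinite)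

text \<open>Closure under negatives follows because they are multiples by minus one.\<close>

lemma (in left_module) submoduleI':
  assumes "H \<subseteq> carrier M" "\<zero>\<^bsub>M\<^esub> \<in> H" "\<And>x y. \<lbrakk>x \<in> H; y \<in> H\<rbrakk> \<Longrightarrow> x \<oplus>\<^bsub>M\<^esub> y \<in> H"
    and "\<And>a x. \<lbrakk>a \<in> carrier R; x \<in> H\<rbrakk> \<Longrightarrow> a \<odot>\<^bsub>M\<^esub> x \<in> H"
  shows "submodule H R M"
proof -
  have "\<ominus>\<^bsub>M\<^esub> x \<in> H" if "x \<in> H" for x
  proof -
    have x: "x \<in> carrier M" using that assms(1) by blast
    have "(\<ominus>\<^bsub>R\<^esub> \<one>\<^bsub>R\<^esub>) \<odot>\<^bsub>M\<^esub> x \<oplus>\<^bsub>M\<^esub> x = ((\<ominus>\<^bsub>R\<^esub> \<one>\<^bsub>R\<^esub>) \<oplus>\<^bsub>R\<^esub> \<one>\<^bsub>R\<^esub>) \<odot>\<^bsub>M\<^esub> x"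
      using x by (simp add: smult_l_distr smult_one)
    also have "\<dots> = \<zero>\<^bsub>M\<^esub>"
      using x by (simp add: R.l_neg zero_smult)
    finally have "\<ominus>\<^bsub>M\<^esub> x = (\<ominus>\<^bsub>R\<^esub> \<one>\<^bsub>R\<^esub>) \<odot>\<^bsub>M\<^esub> x"
      using x by (intro M.minus_equality) (simp_all add: smult_closed)
    then show ?thesis
      using assms(4)[OF _ that] by simp
  qed
  then show ?thesis
    using assms by (intro submodule.intro subgroup.intro submodule_axioms.intro)
      (auto simp: a_inv_def[symmetric])
qed

lemma submoduleD:
  assumes "submodule H R M"
  shows "H \<subseteq> carrier M" "\<zero>\<^bsub>M\<^esub> \<in> H" "\<lbrakk>x \<in> H; y \<in> H\<rbrakk> \<Longrightarrow> x \<oplus>\<^bsub>M\<^esub> y \<in> H"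
    "\<lbrakk>a \<in> carrier R; x \<in> H\<rbrakk> \<Longrightarrow> a \<odot>\<^bsub>M\<^esub> x \<in> H"
  using subgroup.subset[OF submodule.axioms(1)[OF assms]]
    subgroup.one_closed[OF submodule.axioms(1)[OF assms]]
    subgroup.m_closed[OF submodule.axioms(1)[OF assms], of x y]
    submodule.smult_closed[OF assms]
  by auto


subsection \<open>Linear combinations of an equivariant family\<close>

locale supported_module = supported_action \<Psi> A \<phi> X \<tau> s +
  W: left_module "skew_group_ring A (BijGroup \<Psi>) \<phi>" W
  for \<Psi> :: "'p set" and A :: "('a, 'l) ring_scheme" (structure)
    and \<phi> :: "('p \<Rightarrow> 'p) \<Rightarrow> 'a \<Rightarrow> 'a" and X :: "'x set" and \<tau> s
    and W :: "(('p \<Rightarrow> 'p) \<Rightarrow> 'a, 'w, 'n) module_scheme" +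
  fixes \<epsilon> :: "'x \<Rightarrow> 'w"
  assumes family_closed: "x \<in> X \<Longrightarrow> \<epsilon> x \<in> carrier W"
    and family_equivariant: "\<lbrakk>g \<in> carrier (BijGroup \<Psi>); x \<in> X\<rbrakk> \<Longrightarrow>
      \<epsilon> (\<tau> g x) = monomial A \<one> g \<odot>\<^bsub>W\<^esub> \<epsilon> x"
begin

abbreviation "skew \<equiv> skew_group_ring A Sym \<phi>"

text \<open>This is the underlying \<open>A\<close>-module structure of \<open>W\<close>, through
  the embedding of \<open>A\<close> at the identity of the group.\<close>

definition scale :: "'a \<Rightarrow> 'w \<Rightarrow> 'w"
  where "scale a w = monomial A a \<one>\<^bsub>Sym\<^esub> \<odot>\<^bsub>W\<^esub> w"

definition act :: "('p \<Rightarrow> 'p) \<Rightarrow> 'w \<Rightarrow> 'w"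
  where "act g w = monomial A \<one> g \<odot>\<^bsub>W\<^esub> w"

definition combination :: "('x \<Rightarrow> 'a) \<Rightarrow> 'w"
  where "combination f = finsum W (\<lambda>x. scale (f x) (\<epsilon> x)) {x. f x \<noteq> \<zero>}"

lemma monomial_closed:
  "\<lbrakk>a \<in> carrier A; g \<in> carrier Sym\<rbrakk> \<Longrightarrow> monomial A a g \<in> carrier skew"
  by (rule monomial_in_skew_group_ring[OF ring_axioms])

lemma scale_closed: "\<lbrakk>a \<in> carrier A; w \<in> carrier W\<rbrakk> \<Longrightarrow> scale a w \<in> carrier W"
  by (simp add: scale_def W.smult_closed monomial_closed)

lemma act_closed: "\<lbrakk>g \<in> carrier Sym; w \<in> carrier W\<rbrakk> \<Longrightarrow> act g w \<in> carrier W"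
  by (simp add: act_def W.smult_closed monomial_closed)

lemma scale_zero: "w \<in> carrier W \<Longrightarrow> scale \<zero> w = \<zero>\<^bsub>W\<^esub>"
  using W.zero_smult[of w] by (simp add: scale_def monomial_def skew_group_ring_sel)

lemma scale_add:
  assumes "a \<in> carrier A" "b \<in> carrier A" "w \<in> carrier W"
  shows "scale (a \<oplus> b) w = scale a w \<oplus>\<^bsub>W\<^esub> scale b w"
proof -
  have "monomial A (a \<oplus> b) \<one>\<^bsub>Sym\<^esub> = monomial A a \<one>\<^bsub>Sym\<^esub> \<oplus>\<^bsub>skew\<^esub> monomial A b \<one>\<^bsub>Sym\<^esub>"
    by (auto simp: monomial_def skew_group_ring_sel)
  then show ?thesis
    using assms by (simp add: scale_def W.smult_l_distr monomial_closed)
qed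

lemma monomial_smult_smult:
  assumes "a \<in> carrier A" "b \<in> carrier A" "g \<in> carrier Sym" "h \<in> carrier Sym" "w \<in> carrier W"
  shows "monomial A a g \<odot>\<^bsub>W\<^esub> (monomial A b h \<odot>\<^bsub>W\<^esub> w)
    = monomial A (a \<otimes> \<phi> g b) (g \<otimes>\<^bsub>Sym\<^esub> h) \<odot>\<^bsub>W\<^esub> w"
  using assms W.smult_assoc[of "monomial A a g" "monomial A b h" w]
    monomial_mult[OF ring_axioms group_BijGroup coefficient_action assms(1-4)]
  by (simp add: monomial_closed)

lemma coeff_one: "a \<in> carrier A \<Longrightarrow> \<phi> \<one>\<^bsub>Sym\<^esub> a = a"
  by (simp add: coeff.id_eq_one[symmetric])

lemma scale_mult:
  "\<lbrakk>a \<in> carrier A; b \<in> carrier A; w \<in> carrier W\<rbrakk> \<Longrightarrow> scale (a \<otimes> b) w = scale a (scale b w)"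
  by (simp add: scale_def monomial_smult_smult coeff_one)

lemma scale_act:
  "\<lbrakk>a \<in> carrier A; g \<in> carrier Sym; w \<in> carrier W\<rbrakk> \<Longrightarrow> scale a (act g w) = monomial A a g \<odot>\<^bsub>W\<^esub> w"
  by (simp add: scale_def act_def monomial_smult_smult coeff_one)

lemma act_scale:
  assumes "a \<in> carrier A" "g \<in> carrier Sym" "w \<in> carrier W"
  shows "act g (scale a w) = scale (\<phi> g a) (act g w)"
  using assms coeff_closed by (simp add: scale_act) (simp add: scale_def act_def monomial_smult_smult)

text \<open>Zero coefficients give zero terms. This freedom lets two combinations be summed over a
  common index set.\<close>

lemma combination_eq:
  assumes "f \<in> free_module" "finite Z" "{x. f x \<noteq> \<zero>} \<subseteq> Z" "Z \<subseteq> X"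
  shows "combination f = finsum W (\<lambda>x. scale (f x) (\<epsilon> x)) Z"
  unfolding combination_def
  using assms family_closed free_module_closed[OF assms(1)]
  by (intro W.M.add.finprod_mono_neutral_cong_left) (auto simp: scale_zero scale_closed)

lemma combination_terms:
  assumes "f \<in> free_module" "Z \<subseteq> X"
  shows "(\<lambda>x. scale (f x) (\<epsilon> x)) \<in> Z \<rightarrow> carrier W"
  using assms family_closed free_module_closed[OF assms(1)] by (auto simp: scale_closed)

lemma free_moduleD:
  assumes "f \<in> free_module"
  shows "finite {x. f x \<noteq> \<zero>}" "{x. f x \<noteq> \<zero>} \<subseteq> X"
  using assms by (auto simp: free_module_def)

lemma combination_closed: "f \<in> free_module \<Longrightarrow> combination f \<in> carrier W"
  unfolding combination_def by (intro W.M.finsum_closed combination_terms free_moduleD)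

lemma linear_subset_free_module: "linear_subset free_module"
  using linear_subset_vanishing[of "\<lambda>x. False"] by simp

lemma combination_zero: "combination (\<lambda>x. \<zero>) = \<zero>\<^bsub>W\<^esub>"
  by (simp add: combination_def W.M.finsum_empty)

lemma combination_add:
  assumes f: "f \<in> free_module" and h: "h \<in> free_module"
  shows "combination (\<lambda>x. f x \<oplus> h x) = combination f \<oplus>\<^bsub>W\<^esub> combination h"
proof -
  let ?Z = "{x. f x \<noteq> \<zero>} \<union> {x. h x \<noteq> \<zero>}"
  note Z = free_moduleD[OF f] free_moduleD[OF h]
  have fh: "(\<lambda>x. f x \<oplus> h x) \<in> free_module"
    using linear_subsetD(3)[OF linear_subset_free_module f h] .
  have "combination (\<lambda>x. f x \<oplus> h x) = finsum W (\<lambda>x. scale (f x \<oplus> h x) (\<epsilon> x)) ?Z"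
    using Z by (intro combination_eq[OF fh]) auto
  also have "\<dots> = finsum W (\<lambda>x. scale (f x) (\<epsilon> x) \<oplus>\<^bsub>W\<^esub> scale (h x) (\<epsilon> x)) ?Z"
    using Z family_closed free_module_closed[OF f] free_module_closed[OF h]
    by (intro W.M.finsum_cong') (auto simp: scale_add scale_closed)
  also have "\<dots> = finsum W (\<lambda>x. scale (f x) (\<epsilon> x)) ?Z \<oplus>\<^bsub>W\<^esub> finsum W (\<lambda>x. scale (h x) (\<epsilon> x)) ?Z"
    using Z by (intro W.M.finsum_addf combination_terms f h) auto
  also have "\<dots> = combination f \<oplus>\<^bsub>W\<^esub> combination h"
    using Z combination_eq[OF f, of ?Z] combination_eq[OF h, of ?Z] by simp
  finally show ?thesis .
qed

lemma combination_scale: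
  assumes a: "a \<in> carrier A" and f: "f \<in> free_module"
  shows "combination (\<lambda>x. a \<otimes> f x) = scale a (combination f)"
proof -
  let ?Z = "{x. f x \<noteq> \<zero>}"
  note Z = free_moduleD[OF f]
  have af: "(\<lambda>x. a \<otimes> f x) \<in> free_module"
    using linear_subsetD(4)[OF linear_subset_free_module a f] .
  have "combination (\<lambda>x. a \<otimes> f x) = finsum W (\<lambda>x. scale (a \<otimes> f x) (\<epsilon> x)) ?Z"
    using Z a by (intro combination_eq[OF af]) auto
  also have "\<dots> = finsum W (\<lambda>x. scale a (scale (f x) (\<epsilon> x))) ?Z"
    using Z a family_closed free_module_closed[OF f]
    by (intro W.M.finsum_cong') (auto simp: scale_mult scale_closed)
  also have "\<dots> = scale a (combination f)"
    unfolding combination_def scale_def[of a]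
    using W.smult_finsum[OF monomial_closed[OF a Sym.one_closed] combination_terms[OF f Z(2)]] by simp
  finally show ?thesis .
qed

text \<open>Reindexing the sum along \<open>\<tau> g\<close> turns
  \<open>\<epsilon> (\<tau> g x)\<close> into \<open>act g (\<epsilon> x)\<close>, and the twist of
  the coefficients by \<open>\<phi> g\<close> is what moving \<open>act g\<close> past a scalar
  produces.\<close>

lemma combination_translate:
  assumes g: "g \<in> carrier Sym" and f: "f \<in> free_module"
  shows "combination (translate g f) = act g (combination f)"
proof -
  let ?Z = "{x. f x \<noteq> \<zero>}"
  note Z = free_moduleD[OF f]
  have gf: "translate g f \<in> free_module"
    by (rule translate_closed[OF g f])
  have inj: "inj_on (\<tau> g) ?Z"
    using index_cancel(2)[OF g] Z(2) by (intro inj_on_inverseI[of _ "\<tau> (inv\<^bsub>Sym\<^esub> g)"]) auto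
  have im: "\<tau> g ` ?Z \<subseteq> X"
    using index_closed[OF g] Z(2) by auto
  have sub: "{x. translate g f x \<noteq> \<zero>} \<subseteq> \<tau> g ` ?Z"
    by (rule translate_support[OF g])
  have "combination (translate g f)
      = finsum W (\<lambda>x. scale (translate g f x) (\<epsilon> x)) (\<tau> g ` ?Z)"
    using Z(1) by (intro combination_eq[OF gf _ sub im]) simp
  also have "\<dots> = finsum W (\<lambda>x. scale (translate g f (\<tau> g x)) (\<epsilon> (\<tau> g x))) ?Z"
    by (rule W.M.finsum_reindex[OF combination_terms[OF gf im] inj])
  also have "\<dots> = finsum W (\<lambda>x. act g (scale (f x) (\<epsilon> x))) ?Z"
  proof (intro W.M.finsum_cong' refl)
    fix x assume x: "x \<in> ?Z"
    then have xX: "x \<in> X" using Z(2) by blast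
    have "scale (translate g f (\<tau> g x)) (\<epsilon> (\<tau> g x)) = scale (\<phi> g (f x)) (act g (\<epsilon> x))"
      using xX g by (simp add: translate_def index_closed index_cancel family_equivariant act_def)
    then show "scale (translate g f (\<tau> g x)) (\<epsilon> (\<tau> g x)) = act g (scale (f x) (\<epsilon> x))"
      using act_scale[OF free_module_closed[OF f] g family_closed[OF xX]] by simp
  qed (use Z(2) family_closed free_module_closed[OF f] g in \<open>auto simp: act_closed scale_closed\<close>)
  also have "\<dots> = act g (combination f)"
    unfolding combination_def act_def
    using W.smult_finsum[OF monomial_closed[OF one_closed g] combination_terms[OF f Z(2)]] by simp
  finally show ?thesis .
qed

text \<open>Every element of the skew group ring is a finite sum of monomials, and the monomial
  \<open>a[g]\<close> acts as \<open>act g\<close> followed by \<open>scale a\<close>. The induction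
  strips one group element at a time from the support of \<open>p\<close>.\<close>

lemma smult_mem:
  assumes N: "N \<subseteq> carrier W" "\<zero>\<^bsub>W\<^esub> \<in> N" "\<And>v w. \<lbrakk>v \<in> N; w \<in> N\<rbrakk> \<Longrightarrow> v \<oplus>\<^bsub>W\<^esub> w \<in> N"
    and scale: "\<And>a w. \<lbrakk>a \<in> carrier A; w \<in> N\<rbrakk> \<Longrightarrow> scale a w \<in> N"
    and act: "\<And>g w. \<lbrakk>g \<in> carrier Sym; w \<in> N\<rbrakk> \<Longrightarrow> act g w \<in> N"
    and p: "p \<in> carrier skew" and w: "w \<in> N"
  shows "p \<odot>\<^bsub>W\<^esub> w \<in> N"
proof -
  have wW: "w \<in> carrier W" using w N(1) by blast
  have "finite {g. p g \<noteq> \<zero>}"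
    using p by (simp add: skew_group_ring_def)
  then show ?thesis
    using p
  proof (induction "{g. p g \<noteq> \<zero>}" arbitrary: p rule: finite_induct)
    case empty
    then have "p = \<zero>\<^bsub>skew\<^esub>" by (auto simp: skew_group_ring_sel)
    then show ?case using W.zero_smult[OF wW] N(2) by simp
  next
    case (insert g S)
    define q where "q = p(g := \<zero>)"
    have pA: "p x \<in> carrier A" for x
      using insert.prems by (simp add: skew_group_ring_def)
    have g: "g \<in> carrier Sym"
      using insert.prems insert.hyps(4) by (auto simp: skew_group_ring_def)
    have S: "S = {g. q g \<noteq> \<zero>}"
      using insert.hyps(2,4) by (auto simp: q_def)
    have q: "q \<in> carrier skew"
      using insert.prems insert.hyps(1) S by (auto simp: skew_group_ring_def q_def)
    have eq: "p = monomial A (p g) g \<oplus>\<^bsub>skew\<^esub> q"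
      using pA by (auto simp: monomial_def q_def skew_group_ring_sel)
    have "p \<odot>\<^bsub>W\<^esub> w = monomial A (p g) g \<odot>\<^bsub>W\<^esub> w \<oplus>\<^bsub>W\<^esub> q \<odot>\<^bsub>W\<^esub> w"
      using W.smult_l_distr[OF monomial_closed[OF pA[of g] g] q wW, folded eq] .
    moreover have "monomial A (p g) g \<odot>\<^bsub>W\<^esub> w \<in> N"
      using scale[OF pA act[OF g w]] scale_act[OF pA g wW] by simp
    ultimately show ?case
      using N(3) insert.hyps(3)[OF S q] by simp
  qed
qed

text \<open>The image is a submodule and contains each \<open>\<epsilon> x\<close>, hence the
  generators.\<close>

lemma combination_surj:
  assumes "generated_submodule skew W S = carrier W" "S \<subseteq> \<epsilon> ` X"
  shows "combination ` free_module = carrier W"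
proof -
  let ?N = "combination ` free_module"
  have N: "?N \<subseteq> carrier W"
    using combination_closed by blast
  have zero: "\<zero>\<^bsub>W\<^esub> \<in> ?N"
    by (rule image_eqI[where x = "\<lambda>x. \<zero>"])
      (simp_all add: combination_zero linear_subsetD(2)[OF linear_subset_free_module])
  have add: "v \<oplus>\<^bsub>W\<^esub> w \<in> ?N" if vw: "v \<in> ?N" "w \<in> ?N" for v w
  proof -
    obtain f h where "f \<in> free_module" "h \<in> free_module" "v = combination f" "w = combination h"
      using vw by blast
    then show ?thesis
      using linear_subsetD(3)[OF linear_subset_free_module, of f h]
      by (intro image_eqI[where x = "\<lambda>x. f x \<oplus> h x"]) (simp_all add: combination_add)
  qed
  have scale: "scale a w \<in> ?N" if aw: "a \<in> carrier A" "w \<in> ?N" for a w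
  proof -
    obtain f where "f \<in> free_module" "w = combination f"
      using aw(2) by blast
    then show ?thesis
      using aw(1) linear_subsetD(4)[OF linear_subset_free_module, of a f]
      by (intro image_eqI[where x = "\<lambda>x. a \<otimes> f x"]) (simp_all add: combination_scale)
  qed
  have act: "act g w \<in> ?N" if gw: "g \<in> carrier Sym" "w \<in> ?N" for g w
  proof -
    obtain f where "f \<in> free_module" "w = combination f"
      using gw(2) by blast
    then show ?thesis
      using translate_closed[OF gw(1), of f] combination_translate[OF gw(1), of f]
      by (intro image_eqI[where x = "translate g f"]) simp_all
  qed
  have "submodule ?N skew W"
    using N zero add smult_mem[OF N zero add scale act] by (rule W.submoduleI')
  moreover have "\<epsilon> x \<in> ?N" if x: "x \<in> X" for x
  proof (rule image_eqI)
    \<comment> \<open>Here \<open>monomial A \<one> x\<close> is the basis function at an index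
      \<open>x\<close> in \<open>X\<close>, not an element of the skew group ring.\<close>
    have sub: "{y. monomial A \<one> x y \<noteq> \<zero>} \<subseteq> {x}"
      by (auto simp: monomial_def)
    show mono: "monomial A \<one> x \<in> free_module"
      using finite_subset[OF sub] x by (auto simp: free_module_def monomial_def)
    have "combination (monomial A \<one> x) = finsum W (\<lambda>y. scale (monomial A \<one> x y) (\<epsilon> y)) {x}"
      using x by (intro combination_eq[OF mono _ sub]) auto
    also have "\<dots> = scale \<one> (\<epsilon> x)"
      using family_closed[OF x] scale_closed[OF one_closed]
      by (simp add: W.M.finsum_insert W.M.finsum_empty monomial_def)
    also have "\<dots> = \<epsilon> x"
      using W.smult_one[OF family_closed[OF x]] by (simp add: scale_def skew_group_ring_sel)
    finally show "\<epsilon> x = combination (monomial A \<one> x)" by simp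
  qed
  ultimately have "generated_submodule skew W S \<subseteq> ?N"
    unfolding generated_submodule_def using assms(2) by (intro Inter_lower) auto
  then show ?thesis
    using assms(1) N by simp
qed

text \<open>Submodules over \<open>U\<close> pull back along \<open>combination\<close> to sets
  stable under the stabilizer of \<open>T\<close>, as that lies in \<open>U\<close>. Finitely many
  generators of such a preimage map to generators of the submodule.\<close>

lemma noetherian_over_open_subgroup:
  assumes surj: "combination ` free_module = carrier W"
    and bound: "\<And>x. x \<in> X \<Longrightarrow> card (s x) \<le> k"
    and U: "subgroup U Sym" and T: "finite T" "T \<subseteq> \<Psi>" "pointwise_stabilizer \<Psi> T \<subseteq> U"
  shows "noetherian_module (skew_group_ring A (Sym\<lparr>carrier := U\<rparr>) \<phi>) W" (is "noetherian_module ?R' W")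
proof -
  have UG: "U \<subseteq> carrier Sym"
    using U by (rule subgroup.subset)
  have mono_closed: "monomial A a g \<in> carrier ?R'" if "a \<in> carrier A" "g \<in> U" for a g
    using monomial_in_skew_group_ring[OF ring_axioms that(1), of g "Sym\<lparr>carrier := U\<rparr>"] that(2) by simp
  define pre where "pre N = {f \<in> free_module. combination f \<in> N}" for N
  have pre_stable: "stable_subset T (pre N)" if N: "submodule N ?R' W" for N
  proof -
    note N' = submoduleD[OF N]
    have scale: "scale a w \<in> N" if "a \<in> carrier A" "w \<in> N" for a w
      unfolding scale_def using that by (intro N'(4) mono_closed subgroup.one_closed[OF U])
    have act: "act g w \<in> N" if "g \<in> U" "w \<in> N" for g w
      unfolding act_def using that by (intro N'(4) mono_closed one_closed)
    have "linear_subset (pre N)"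
      unfolding linear_subset_def
    proof (intro conjI ballI)
      show "pre N \<subseteq> free_module" by (auto simp: pre_def)
      show "(\<lambda>x. \<zero>) \<in> pre N"
        using linear_subsetD(2)[OF linear_subset_free_module] N'(2) by (simp add: pre_def combination_zero)
      show "(\<lambda>x. f x \<oplus> h x) \<in> pre N" if "f \<in> pre N" "h \<in> pre N" for f h
        using that linear_subsetD(3)[OF linear_subset_free_module, of f h] N'(3)
        by (simp add: pre_def combination_add)
      show "(\<lambda>x. a \<otimes> f x) \<in> pre N" if "a \<in> carrier A" "f \<in> pre N" for a f
        using that linear_subsetD(4)[OF linear_subset_free_module, of a f] scale
        by (simp add: pre_def combination_scale)
    qed
    moreover have "translate g f \<in> pre N" if "g \<in> pointwise_stabilizer \<Psi> T" "f \<in> pre N" for g f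
    proof -
      have "g \<in> U" "g \<in> carrier Sym" using that(1) T(3) UG by blast+
      then show ?thesis
        using that(2) act translate_closed by (simp add: pre_def combination_translate)
    qed
    ultimately show ?thesis
      by (simp add: stable_subset_def)
  qed
  have "\<exists>S. finite S \<and> S \<subseteq> carrier W \<and> generated_submodule ?R' W S = N"
    if N: "submodule N ?R' W" for N
  proof -
    have "card (s x - T) < Suc k" if "f \<in> pre N" "f x \<noteq> \<zero>" for f x
    proof -
      have "x \<in> X" using that free_moduleD(2)[of f] by (auto simp: pre_def)
      then show ?thesis
        using bound[of x] card_mono[OF finite_support, of x "s x - T"] by simp
    qed
    then have "\<exists>B. finite B \<and> B \<subseteq> pre N \<and> (\<forall>M. stable_subset T M \<and> B \<subseteq> M \<longrightarrow> pre N \<subseteq> M)"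
      by (rule stable_subset_finitely_generated[OF T(1,2) pre_stable[OF N]])
    then obtain B where B: "finite B" "B \<subseteq> pre N"
      and gen: "\<forall>M. stable_subset T M \<and> B \<subseteq> M \<longrightarrow> pre N \<subseteq> M"
      by (elim exE conjE)
    have im: "combination ` B \<subseteq> N"
      using B(2) by (auto simp: pre_def)
    \<comment> \<open>The preimage of \<open>N'\<close> contains \<open>B\<close>, hence all of
      \<open>pre N\<close>; surjectivity brings this inclusion back to \<open>W\<close>.\<close>
    have "N \<subseteq> N'" if N': "submodule N' ?R' W" "combination ` B \<subseteq> N'" for N'
    proof
      fix w assume w: "w \<in> N"
      then obtain f where f: "f \<in> free_module" "w = combination f"
        using surj submoduleD(1)[OF N] by blast
      have "B \<subseteq> pre N'"
        using N'(2) B(2) by (auto simp: pre_def)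
      then have "pre N \<subseteq> pre N'"
        using gen pre_stable[OF N'(1)] by simp
      moreover have "f \<in> pre N"
        using f w by (simp add: pre_def)
      ultimately show "w \<in> N'"
        using f(2) by (auto simp: pre_def)
    qed
    then have "generated_submodule ?R' W (combination ` B) = N"
      unfolding generated_submodule_def using N im by (intro equalityI Inter_lower Inter_greatest) simp_all
    then show ?thesis
      using B(1) im submoduleD(1)[OF N] by (intro exI[of _ "combination ` B"]) simp
  qed
  then show ?thesis
    unfolding noetherian_module_def
    using left_module_skew_group_ring_subgroup[OF ring_axioms U W.left_module_axioms] by simp
qed

end

section \<open>An equivariant presentation of a smooth finitely generated module\<close>

theorem theorem3p18:
  fixes \<Psi> :: "'p set"
    and A :: "('a, 'l) ring_scheme"
    and \<phi> :: "('p \<Rightarrow> 'p) \<Rightarrow> 'a \<Rightarrow> 'a"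
    and W :: "(('p \<Rightarrow> 'p) \<Rightarrow> 'a, 'w, 'n) module_scheme"
    and U :: "('p \<Rightarrow> 'p) set"
  assumes "left_noetherian_ring A"
    and "ring_action (BijGroup \<Psi>) A \<phi>"
    and "smooth_action \<Psi> (carrier A) \<phi>"
    and "finitely_generated_module (skew_group_ring A (BijGroup \<Psi>) \<phi>) W"
    and "smooth_action \<Psi> (carrier W) (skew_module_action A W)"
    and "subgroup U (BijGroup \<Psi>)"
    and "openin (sym_topology \<Psi>) U"
  shows "noetherian_module (skew_group_ring A ((BijGroup \<Psi>)\<lparr>carrier := U\<rparr>) \<phi>) W"
proof -
  let ?G = "BijGroup \<Psi>" and ?\<alpha> = "skew_module_action A W"
  let ?R = "skew_group_ring A ?G \<phi>"
  interpret G: group ?G by (rule group_BijGroup)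
  interpret W: left_module ?R W
    using assms(4) by (simp add: finitely_generated_module_def)
  interpret \<alpha>: group_action ?G "carrier W" ?\<alpha>
    using assms(5) by (simp add: smooth_action_def)
  obtain S where S: "finite S" "S \<subseteq> carrier W" "generated_submodule ?R W S = carrier W"
    using assms(4) by (auto simp: finitely_generated_module_def)
  \<comment> \<open>The stabilizer of a generator is an open neighbourhood of the identity, so it
    contains a basic one.\<close>
  have "\<exists>F. finite F \<and> F \<subseteq> \<Psi> \<and> pointwise_stabilizer \<Psi> F \<subseteq> stabilizer ?G ?\<alpha> w" if "w \<in> S" for w
  proof -
    have w: "w \<in> carrier W" using that S(2) by blast
    have "openin (sym_topology \<Psi>) (stabilizer ?G ?\<alpha> w)"
      using assms(5) w by (simp add: smooth_action_def)
    moreover have "\<one>\<^bsub>?G\<^esub> \<in> stabilizer ?G ?\<alpha> w"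
      using w by (simp add: stabilizer_def \<alpha>.id_eq_one[symmetric])
    ultimately show ?thesis
      by (metis sym_topology_base_at_one)
  qed
  then obtain F' where F': "\<And>w. w \<in> S \<Longrightarrow>
      finite (F' w) \<and> F' w \<subseteq> \<Psi> \<and> pointwise_stabilizer \<Psi> (F' w) \<subseteq> stabilizer ?G ?\<alpha> w"
    by metis
  \<comment> \<open>One finite set for all generators: permutations fixing it pointwise fix every
    \<open>w\<close> in \<open>S\<close>.\<close>
  define F where "F = (\<Union>w\<in>S. F' w)"
  have F: "finite F" "F \<subseteq> \<Psi>"
    using S(1) F' by (auto simp: F_def)
  have fixed: "?\<alpha> g w = w" if "w \<in> S" "g \<in> carrier ?G" "\<And>x. x \<in> F \<Longrightarrow> g x = x" for g w
  proof -
    have "g \<in> pointwise_stabilizer \<Psi> (F' w)"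
      using that by (auto simp: pointwise_stabilizer_def F_def)
    then show ?thesis
      using F'[OF that(1)] by (auto simp: stabilizer_def)
  qed
  obtain T where T: "finite T" "T \<subseteq> \<Psi>" "pointwise_stabilizer \<Psi> T \<subseteq> U"
    using sym_topology_base_at_one[OF assms(7) subgroup.one_closed[OF assms(6)]] .
  have mult_apply: "(g \<otimes>\<^bsub>?G\<^esub> h) x = g (h x)"
    if "g \<in> carrier ?G" "h \<in> carrier ?G" "x \<in> \<Psi>" for g h x
    using that by (simp add: BijGroup_def compose_def)
  have into: "g x \<in> \<Psi>" if "g \<in> carrier ?G" "x \<in> F" for g x
    using that F(2) by (auto simp: BijGroup_def Bij_def bij_betw_def)
  \<comment> \<open>The inverse of \<open>h\<close> times \<open>g\<close> fixes \<open>F\<close>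
    pointwise and hence fixes \<open>w\<close>. So the translate of \<open>w\<close> by
    \<open>g\<close> depends only on the restriction of \<open>g\<close> to
    \<open>F\<close>.\<close>
  have agree: "?\<alpha> g w = ?\<alpha> h w"
    if w: "w \<in> S" and g: "g \<in> carrier ?G" and h: "h \<in> carrier ?G" and eq: "\<And>x. x \<in> F \<Longrightarrow> g x = h x" for g h w
  proof -
    have wW: "w \<in> carrier W" using w S(2) by blast
    let ?k = "inv\<^bsub>?G\<^esub> h \<otimes>\<^bsub>?G\<^esub> g"
    have "?k x = x" if "x \<in> F" for x
    proof -
      have x: "x \<in> \<Psi>" using that F(2) by blast
      have "?k x = (inv\<^bsub>?G\<^esub> h \<otimes>\<^bsub>?G\<^esub> h) x"
        using mult_apply[OF G.inv_closed[OF h] g x] mult_apply[OF G.inv_closed[OF h] h x] eq[OF that]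
        by metis
      also have "\<dots> = x"
        unfolding G.l_inv[OF h] using x by (simp add: BijGroup_def)
      finally show ?thesis .
    qed
    then have "?\<alpha> ?k w = w"
      using fixed[OF w] g h by simp
    then have "?\<alpha> h w = ?\<alpha> (h \<otimes>\<^bsub>?G\<^esub> ?k) w"
      using \<alpha>.composition_rule[OF wW h, of ?k] g h by simp
    also have "h \<otimes>\<^bsub>?G\<^esub> ?k = g"
      using g h G.inv_solve_left[of ?k h g] by simp
    finally show ?thesis by simp
  qed
  \<comment> \<open>The indices are the translates of the pairs \<open>(w, F)\<close>. Carrying the
    set along gives each vector an equivariant support of at most \<open>card F\<close>
    points.\<close>
  define X where "X = (\<lambda>(g, w). (?\<alpha> g w, g ` F)) ` (carrier ?G \<times> S)"
  define \<tau> where "\<tau> g x = (?\<alpha> g (fst x), g ` snd x)" for g x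
  have image_mult: "(g \<otimes>\<^bsub>?G\<^esub> h) ` E = g ` h ` E"
    if "g \<in> carrier ?G" "h \<in> carrier ?G" "E \<subseteq> \<Psi>" for g h E
    using mult_apply[OF that(1,2)] that(3) by (force simp: image_image)
  have XW: "fst x \<in> carrier W" and X\<Psi>: "snd x \<subseteq> \<Psi>" and Xfin: "finite (snd x)"
    and Xcard: "card (snd x) \<le> card F" if "x \<in> X" for x
    using that S(2) F into \<alpha>.element_image card_image_le[OF F(1)] by (auto simp: X_def)
  interpret supported_module \<Psi> A \<phi> X \<tau> snd W fst
  proof unfold_locales
    show "left_noetherian_ring A" "ring_action ?G A \<phi>" by fact+
  next
    fix g x assume g: "g \<in> carrier ?G" and x: "x \<in> X"
    show "snd (\<tau> g x) = g ` snd x"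
      by (simp add: \<tau>_def)
    show "fst (\<tau> g x) = monomial A \<one>\<^bsub>A\<^esub> g \<odot>\<^bsub>W\<^esub> fst x"
      using XW[OF x] by (simp add: \<tau>_def skew_module_action_def)
    obtain h w where hw: "h \<in> carrier ?G" "w \<in> S" "x = (?\<alpha> h w, h ` F)"
      using x by (auto simp: X_def)
    have "\<tau> g x = (?\<alpha> (g \<otimes>\<^bsub>?G\<^esub> h) w, (g \<otimes>\<^bsub>?G\<^esub> h) ` F)"
      using \<alpha>.composition_rule[OF _ g hw(1), of w] hw S(2) image_mult[OF g hw(1) F(2)]
      by (auto simp: \<tau>_def)
    then show "\<tau> g x \<in> X"
      using g hw by (auto simp: X_def)
  next
    fix g h x assume g: "g \<in> carrier ?G" and h: "h \<in> carrier ?G" and x: "x \<in> X"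
    show "\<tau> (g \<otimes>\<^bsub>?G\<^esub> h) x = \<tau> g (\<tau> h x)"
      using \<alpha>.composition_rule[OF XW[OF x] g h] image_mult[OF g h X\<Psi>[OF x]]
      by (simp add: \<tau>_def)
  next
    fix x assume x: "x \<in> X"
    show "\<tau> \<one>\<^bsub>?G\<^esub> x = x"
    proof -
      have "\<one>\<^bsub>?G\<^esub> ` snd x = snd x"
        using X\<Psi>[OF x] by (force simp: BijGroup_def)
      then show ?thesis
        using XW[OF x] by (simp add: \<tau>_def \<alpha>.id_eq_one[symmetric])
    qed
  next
    fix J :: "'p set" assume J: "finite J"
    \<comment> \<open>A permutation restricting to \<open>h\<close>; the value is arbitrary, and
      irrelevant, when there is none.\<close>
    define ext where "ext h = (SOME g. g \<in> carrier ?G \<and> restrict g F = h)" for h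
    \<comment> \<open>By \<open>agree\<close>, an index supported in \<open>J\<close> is determined
      by a generator and a function from \<open>F\<close> to \<open>J\<close>.\<close>
    have "{x \<in> X. snd x \<subseteq> J} \<subseteq> (\<lambda>(h, w). (?\<alpha> (ext h) w, h ` F)) ` ((F \<rightarrow>\<^sub>E J) \<times> S)"
    proof
      fix x assume "x \<in> {x \<in> X. snd x \<subseteq> J}"
      then obtain g w where gw: "g \<in> carrier ?G" "w \<in> S" "x = (?\<alpha> g w, g ` F)" "g ` F \<subseteq> J"
        by (auto simp: X_def)
      let ?h = "restrict g F"
      have ext: "ext ?h \<in> carrier ?G \<and> restrict (ext ?h) F = ?h"
        unfolding ext_def by (rule someI[of _ g]) (simp add: gw(1))
      have "?\<alpha> (ext ?h) w = ?\<alpha> g w"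
        using ext gw(1,2) by (intro agree) (simp_all, metis restrict_apply')
      then show "x \<in> (\<lambda>(h, w). (?\<alpha> (ext h) w, h ` F)) ` ((F \<rightarrow>\<^sub>E J) \<times> S)"
        using gw by (intro image_eqI[where x = "(?h, w)"]) auto
    qed
    moreover have "finite ((F \<rightarrow>\<^sub>E J) \<times> S)"
      using F(1) J S(1) by (intro finite_cartesian_product finite_PiE)
    ultimately show "finite {x \<in> X. snd x \<subseteq> J}"
      by (meson finite_imageI finite_subset)
  qed (use XW X\<Psi> Xfin in auto)
  have "S \<subseteq> fst ` X"
  proof
    fix w assume w: "w \<in> S"
    then have "(?\<alpha> \<one>\<^bsub>?G\<^esub> w, \<one>\<^bsub>?G\<^esub> ` F) \<in> X"
      by (auto simp: X_def)
    then show "w \<in> fst ` X"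
      using w S(2) by (intro image_eqI) (auto simp: \<alpha>.id_eq_one[symmetric])
  qed
  then show ?thesis
    using noetherian_over_open_subgroup[OF combination_surj[OF S(3)] Xcard assms(6) T] by simp
qed

end
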